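(* Broder's chain is not rapidly mixing on each of the following classes of bipartite graphs: planar bipartite graphs, regular bipartite graphs, Hamiltonian bipartite graphs, and bipartite threshold graphs. That is, for each of these four classes $\mathfrak{G}$ there is no polynomial $p$ such that for every graph $G\in\mathfrak{G}$ with $2n$ vertices and at least one perfect matching, and every $\epsilon\in(0,1)$, the total mixing time of Broder's chain on $G$ satisfies $\tau(\epsilon)\le p(n)\left(\ln(\epsilon^{-1})+\ln(\pi_{\min}^{-1})\right)$.
   Context: Let $G=(U\cup V,E)$ be a bipartite graph with $|U|=|V|=n$ and $m=|E|$. $M(G)$ denotes the set of perfect matchings of $G$; $N(G)$ the set of near-perfect matchings, i.e. matchings of size $n-1$ (leaving exactly one vertex of $U$ and one of $V$ unmatched); for $u\in U,v\in V$, $N_{uv}(G)\subseteq N(G)$ is the set of near-perfect matchings leaving exactly $u$ and $v$ unmatched. Broder's chain (as defined by Jerrum and Sinclair) is the Markov chain on $\Omega=M(G)\cup N(G)$ which, from a state $M$, stays at $M$ with probability $1/2$, and otherwise chooses an edge $e=\{u,v\}\in E$ ($u\in U$, $v\in V$) uniformly at random and moves to: $M\setminus\{e\}$ if $M\in M(G)$ and $e\in M$; $M\cup\{e\}$ if $M\in N_{uv}(G)$; $M\cup\{e\}\setminus\{e'\}$ if $M\in N(G)$, exactly one of $u,v$ is unmatched in $M$ and the other is matched by the edge $e'\in M$; and stays at $M$ otherwise. Its stationary distribution $\pi$ is uniform on $\Omega$, and $\pi_{\min}$ is the smallest value of $\pi$. For a start state $x$, $p^t_x$ is the distribution after $t$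 steps; $d(\pi,t)=\max_{x\in\Omega}\frac12\sum_{y\in\Omega}|\pi(y)-p^t_x(y)|$, and the total mixing time is $\tau(\epsilon)=\min\{t: d(\pi,t)\le\epsilon\}$. A bipartite graph is a threshold graph if no other bipartite graph on the same vertex bipartition has the same vertex degrees (equivalently, after ordering, its biadjacency matrix has each row consisting of a block of ones followed by zeros, with row lengths nonincreasing, i.e. a Ferrers matrix). *)

theory Defs
  imports "HOL-Probability.Probability" "HOL-Computational_Algebra.Polynomial"
begin

text \<open>
  The two sides of the bipartition have types of their own, so that they are disjoint by
  construction: an edge is a pair, and the vertex set is the disjoint sum of the two sides.
\<close>

record ('a, 'b) bigraph =
  lverts :: "'a set"
  rverts :: "'b set"
  edges :: "('a \<times> 'b) set"

definition bigraph :: "('a, 'b) bigraph \<Rightarrow> bool" where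
  "bigraph G \<longleftrightarrow> finite (lverts G) \<and> finite (rverts G) \<and> card (lverts G) = card (rverts G) \<and>
     edges G \<subseteq> lverts G \<times> rverts G"

definition verts :: "('a, 'b) bigraph \<Rightarrow> ('a + 'b) set" where
  "verts G = lverts G <+> rverts G"

definition adjacent :: "('a, 'b) bigraph \<Rightarrow> 'a + 'b \<Rightarrow> 'a + 'b \<Rightarrow> bool" where
  "adjacent G x y \<longleftrightarrow> (\<exists>(u, v) \<in> edges G. x = Inl u \<and> y = Inr v \<or> x = Inr v \<and> y = Inl u)"

definition vdegree :: "('a, 'b) bigraph \<Rightarrow> 'a + 'b \<Rightarrow> nat" where
  "vdegree G x = card {y. adjacent G x y}"


section \<open>Matchings\<close>

definition matchings :: "('a, 'b) bigraph \<Rightarrow> ('a \<times> 'b) set set" where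
  "matchings G = {M. M \<subseteq> edges G \<and>
     (\<forall>e\<in>M. \<forall>e'\<in>M. e \<noteq> e' \<longrightarrow> fst e \<noteq> fst e' \<and> snd e \<noteq> snd e')}"

definition perfect_matchings :: "('a, 'b) bigraph \<Rightarrow> ('a \<times> 'b) set set" where
  "perfect_matchings G = {M \<in> matchings G. fst ` M = lverts G \<and> snd ` M = rverts G}"

definition near_perfect_matchings :: "('a, 'b) bigraph \<Rightarrow> ('a \<times> 'b) set set" where
  "near_perfect_matchings G = {M \<in> matchings G. card M + 1 = card (lverts G)}"

definition near_perfect_matchings_at :: "('a, 'b) bigraph \<Rightarrow> 'a \<Rightarrow> 'b \<Rightarrow> ('a \<times> 'b) set set" where
  "near_perfect_matchings_at G u v =
     {M \<in> near_perfect_matchings G. lverts G - fst ` M = {u} \<and> rverts G - snd ` M = {v}}"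


section \<open>Broder's chain\<close>

definition states :: "('a, 'b) bigraph \<Rightarrow> ('a \<times> 'b) set set" where
  "states G = perfect_matchings G \<union> near_perfect_matchings G"

text \<open>
  In the third and fourth case, the set that is removed is \<open>{e'}\<close> for the unique edge
  \<open>e'\<close> of the matching at the matched endpoint.
\<close>

definition broder_move ::
    "('a, 'b) bigraph \<Rightarrow> ('a \<times> 'b) set \<Rightarrow> 'a \<times> 'b \<Rightarrow> ('a \<times> 'b) set" where
  "broder_move G M = (\<lambda>(u, v).
     if M \<in> perfect_matchings G \<and> (u, v) \<in> M then M - {(u, v)}
     else if M \<in> near_perfect_matchings_at G u v then insert (u, v) M
     else if M \<in> near_perfect_matchings G \<and> u \<notin> fst ` M \<and> v \<in> snd ` M
       then insert (u, v) M - {e' \<in> M. snd e' = v}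
     else if M \<in> near_perfect_matchings G \<and> u \<in> fst ` M \<and> v \<notin> snd ` M
       then insert (u, v) M - {e' \<in> M. fst e' = u}
     else M)"

text \<open>Meaningful only if the graph has an edge, as \<^const>\<open>pmf_of_set\<close> needs a non-empty set.\<close>

definition broder_step ::
    "('a, 'b) bigraph \<Rightarrow> ('a \<times> 'b) set \<Rightarrow> ('a \<times> 'b) set pmf" where
  "broder_step G M = bind_pmf (bernoulli_pmf (1/2)) (\<lambda>stay.
     if stay then return_pmf M else map_pmf (broder_move G M) (pmf_of_set (edges G)))"

definition broder_dist ::
    "('a, 'b) bigraph \<Rightarrow> nat \<Rightarrow> ('a \<times> 'b) set \<Rightarrow> ('a \<times> 'b) set pmf" where
  "broder_dist G t x = ((\<lambda>\<mu>. bind_pmf \<mu> (broder_step G)) ^^ t) (return_pmf x)"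

definition stationary :: "('a, 'b) bigraph \<Rightarrow> ('a \<times> 'b) set pmf" where
  "stationary G = pmf_of_set (states G)"

definition pi_min :: "('a, 'b) bigraph \<Rightarrow> real" where
  "pi_min G = Min (pmf (stationary G) ` states G)"

definition max_distance :: "('a, 'b) bigraph \<Rightarrow> nat \<Rightarrow> real" where
  "max_distance G t = Max ((\<lambda>x. 1/2 * (\<Sum>y\<in>states G.
     \<bar>pmf (stationary G) y - pmf (broder_dist G t x) y\<bar>)) ` states G)"

text \<open>
  A minimum of a set of natural numbers; it is taken in \<^typ>\<open>enat\<close> so that an empty set would
  give \<open>\<infinity>\<close> rather than an arbitrary number.
\<close>

definition mixing_time :: "('a, 'b) bigraph \<Rightarrow> real \<Rightarrow> enat" where
  "mixing_time G \<epsilon> = Inf (enat ` {t. max_distance G t \<le> \<epsilon>})"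

text \<open>
  The trivial graph without vertices is excluded, since it has no edge to choose. If
  there is a vertex and a perfect matching, then there is an edge.
\<close>

definition rapidly_mixing_on :: "('a, 'b) bigraph set \<Rightarrow> bool" where
  "rapidly_mixing_on \<GG> \<longleftrightarrow> (\<exists>p :: real poly. \<forall>G\<in>\<GG>. \<forall>n::nat. \<forall>\<epsilon>::real.
     card (lverts G) = n \<and> n \<ge> 1 \<and> perfect_matchings G \<noteq> {} \<and> 0 < \<epsilon> \<and> \<epsilon> < 1 \<longrightarrow>
     ereal_of_enat (mixing_time G \<epsilon>) \<le>
       ereal (poly p (real n) * (ln (1 / \<epsilon>) + ln (1 / pi_min G))))"


section \<open>Classes of bipartite graphs\<close>

text \<open>
  A plane drawing: vertices are distinct points, edges are arcs between their endpoints that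
  meet no further vertex, and two edges meet only in a common endpoint.
\<close>

definition planar :: "('a, 'b) bigraph \<Rightarrow> bool" where
  "planar G \<longleftrightarrow> (\<exists>(pos :: 'a + 'b \<Rightarrow> complex) (\<gamma> :: 'a \<times> 'b \<Rightarrow> real \<Rightarrow> complex).
     inj_on pos (verts G) \<and>
     (\<forall>(u, v)\<in>edges G. arc (\<gamma> (u, v)) \<and>
        pathstart (\<gamma> (u, v)) = pos (Inl u) \<and> pathfinish (\<gamma> (u, v)) = pos (Inr v) \<and>
        path_image (\<gamma> (u, v)) \<inter> pos ` verts G = {pos (Inl u), pos (Inr v)}) \<and>
     (\<forall>e\<in>edges G. \<forall>e'\<in>edges G. e \<noteq> e' \<longrightarrow>
        path_image (\<gamma> e) \<inter> path_image (\<gamma> e') \<subseteq> pos ` verts G))"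

definition regular :: "('a, 'b) bigraph \<Rightarrow> bool" where
  "regular G \<longleftrightarrow> (\<exists>d. \<forall>x\<in>verts G. vdegree G x = d)"

definition hamiltonian :: "('a, 'b) bigraph \<Rightarrow> bool" where
  "hamiltonian G \<longleftrightarrow> (\<exists>xs. distinct xs \<and> set xs = verts G \<and> length xs \<ge> 3 \<and>
     (\<forall>i<length xs. adjacent G (xs ! i) (xs ! ((i + 1) mod length xs))))"

definition threshold :: "('a, 'b) bigraph \<Rightarrow> bool" where
  "threshold G \<longleftrightarrow> (\<forall>E'. E' \<subseteq> lverts G \<times> rverts G \<longrightarrow>
     (\<forall>x\<in>verts G. vdegree (G\<lparr>edges := E'\<rparr>) x = vdegree G x) \<longrightarrow> E' = edges G)"


section \<open>The uniform distribution is stationary for Broder's chain\<close>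

lemma finite_states:
  assumes "bigraph G" shows "finite (states G)" "finite (edges G)"
proof -
  have "edges G \<subseteq> lverts G \<times> rverts G" "finite (lverts G \<times> rverts G)" using assms unfolding bigraph_def by auto
  then show f: "finite (edges G)" by (rule finite_subset)
  have "states G \<subseteq> Pow (edges G)" unfolding states_def perfect_matchings_def near_perfect_matchings_def matchings_def by auto
  then show "finite (states G)" using f by (simp add: finite_subset)
qed

lemma matchingD: "M \<in> matchings G \<Longrightarrow> (a,b) \<in> M \<Longrightarrow> (c,d) \<in> M \<Longrightarrow> a = c \<longleftrightarrow> b = d"
  unfolding matchings_def by fastforce

lemma matching_unique:
  assumes "M \<in> matchings G"
  shows "(a,b) \<in> M \<Longrightarrow> (a,d) \<in> M \<Longrightarrow> d = b" "(a,b) \<in> M \<Longrightarrow> (c,b) \<in> M \<Longrightarrow> c = a"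
  using matchingD[OF assms] by blast+

lemma matchingI:
  assumes "\<And>a b. (a,b) \<in> M \<Longrightarrow> (a,b) \<in> edges G"
    "\<And>a b c d. (a,b) \<in> M \<Longrightarrow> (c,d) \<in> M \<Longrightarrow> a = c \<Longrightarrow> b = d"
    "\<And>a b c d. (a,b) \<in> M \<Longrightarrow> (c,d) \<in> M \<Longrightarrow> b = d \<Longrightarrow> a = c"
  shows "M \<in> matchings G"
  unfolding matchings_def using assms(1) by (auto dest: assms(2,3))

lemma card_matching:
  assumes "M \<in> matchings G" shows "card (fst ` M) = card M" "card (snd ` M) = card M"
  using assms unfolding matchings_def by (auto intro!: card_image inj_onI)

lemma perfect_iff:
  assumes "bigraph G" shows "M \<in> perfect_matchings G \<longleftrightarrow> M \<in> matchings G \<and> card M = card (lverts G)"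
proof -
  have "fst ` M \<subseteq> lverts G" "snd ` M \<subseteq> rverts G" if "M \<in> matchings G"
    using that assms unfolding matchings_def bigraph_def by auto
  then show ?thesis using assms card_matching[of M G] unfolding perfect_matchings_def bigraph_def
    using card_subset_eq[of "lverts G" "fst ` M"] card_subset_eq[of "rverts G" "snd ` M"] by auto
qed

lemma slide_in:
  assumes G: "bigraph G" and M: "M \<in> near_perfect_matchings G" and e: "(u,v) \<in> edges G"
   and u: "u \<notin> fst ` M" and e': "(u',v) \<in> M"
  defines "M' \<equiv> insert (u,v) (M - {(u',v)})"
  shows "broder_move G M (u,v) = M'" "M' \<in> near_perfect_matchings G" "(u',v) \<in> edges G" "u' \<notin> fst ` M'" "(u,v) \<in> M'" "M = insert (u',v) (M' - {(u,v)})"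
proof -
  have m: "M \<in> matchings G" and fin: "finite M" using M finite_states[OF G] unfolding near_perfect_matchings_def matchings_def by (auto intro: finite_subset)
  have np: "M \<notin> perfect_matchings G" using M G by (auto simp: perfect_iff near_perfect_matchings_def)
  have uv: "(u,v) \<notin> M" "u \<noteq> u'" using u e' imageI[of "(u,v)" M fst] by auto
  have eq: "{e' \<in> M. snd e' = v} = {(u',v)}" using e' by (auto dest: matching_unique[OF m e'])
  have v: "v \<in> snd ` M" using e' by force
  have na: "M \<notin> near_perfect_matchings_at G u v" using v unfolding near_perfect_matchings_at_def by auto
  show "broder_move G M (u,v) = M'" unfolding broder_move_def M'_def using np na M u v eq uv by auto
  show "(u',v) \<in> edges G" using e' m unfolding matchings_def by auto
  have c: "card M' = card M" unfolding M'_def using e' uv fin card_Suc_Diff1[of M] by (auto simp: card_insert_if)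
  have "M' \<in> matchings G"
  proof (rule matchingI)
    fix a b assume "(a,b) \<in> M'" then show "(a,b) \<in> edges G" using e m unfolding M'_def matchings_def by auto
  next
    fix a b c d assume "(a,b) \<in> M'" "(c,d) \<in> M'" "a = c"
    then show "b = d" using matchingD[OF m, of a b c d] u unfolding M'_def by (auto simp: rev_image_eqI)
    next
    fix a b c d assume "(a,b) \<in> M'" "(c,d) \<in> M'" "b = d"
    then show "a = c" using matchingD[OF m, of a b c d] matchingD[OF m, of a b u' v] matchingD[OF m, of u' v c d] e' unfolding M'_def by auto
  qed
  then show "M' \<in> near_perfect_matchings G" using M c unfolding near_perfect_matchings_def by auto
  show "u' \<notin> fst ` M'" using uv unfolding M'_def by (auto dest: matching_unique[OF m e'])
  show "(u,v) \<in> M'" "M = insert (u',v) (M' - {(u,v)})" using uv e' unfolding M'_def by auto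
qed

lemma slide_in2:
  assumes G: "bigraph G" and M: "M \<in> near_perfect_matchings G" and e: "(u,v) \<in> edges G"
   and u: "v \<notin> snd ` M" and e': "(u,v') \<in> M"
  defines "M' \<equiv> insert (u,v) (M - {(u,v')})"
  shows "broder_move G M (u,v) = M'" "M' \<in> near_perfect_matchings G" "(u,v') \<in> edges G" "v' \<notin> snd ` M'" "(u,v) \<in> M'" "M = insert (u,v') (M' - {(u,v)})"
proof -
  have m: "M \<in> matchings G" and fin: "finite M" using M finite_states[OF G] unfolding near_perfect_matchings_def matchings_def by (auto intro: finite_subset)
  have np: "M \<notin> perfect_matchings G" using M G by (auto simp: perfect_iff near_perfect_matchings_def)
  have uv: "(u,v) \<notin> M" "v \<noteq> v'" using u e' imageI[of "(u,v)" M snd] by auto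
  have eq: "{e' \<in> M. fst e' = u} = {(u,v')}" using e' by (auto dest: matching_unique[OF m e'])
  have v: "u \<in> fst ` M" using e' by force
  have na: "M \<notin> near_perfect_matchings_at G u v" using v unfolding near_perfect_matchings_at_def by auto
  show "broder_move G M (u,v) = M'" unfolding broder_move_def M'_def using np na M u v eq uv by auto
  show "(u,v') \<in> edges G" using e' m unfolding matchings_def by auto
  have c: "card M' = card M" unfolding M'_def using e' uv fin card_Suc_Diff1[of M] by (auto simp: card_insert_if)
  have "M' \<in> matchings G"
  proof (rule matchingI)
    fix a b assume "(a,b) \<in> M'" then show "(a,b) \<in> edges G" using e m unfolding M'_def matchings_def by auto
  next
    fix a b c d assume "(a,b) \<in> M'" "(c,d) \<in> M'" "b = d"
    then show "a = c" using matchingD[OF m, of a b c d] u unfolding M'_def by (auto simp: rev_image_eqI)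
    next
    fix a b c d assume "(a,b) \<in> M'" "(c,d) \<in> M'" "a = c"
    then show "b = d" using matchingD[OF m, of a b c d] matchingD[OF m, of a b u v'] matchingD[OF m, of u v' c d] e' unfolding M'_def by auto
  qed
  then show "M' \<in> near_perfect_matchings G" using M c unfolding near_perfect_matchings_def by auto
  show "v' \<notin> snd ` M'" using uv unfolding M'_def by (auto dest: matching_unique[OF m e'])
  show "(u,v) \<in> M'" "M = insert (u,v') (M' - {(u,v)})" using uv e' unfolding M'_def by auto
qed

lemma remove_in:
  assumes G: "bigraph G" and M: "M \<in> perfect_matchings G" and e: "(u,v) \<in> M"
  shows "broder_move G M (u,v) = M - {(u,v)}" "M - {(u,v)} \<in> near_perfect_matchings_at G u v"
        "(u,v) \<in> edges G"
proof -
  have m: "M \<in> matchings G" and fin: "finite M" using M finite_states[OF G] unfolding perfect_matchings_def matchings_def by (auto intro: finite_subset)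
  show "broder_move G M (u,v) = M - {(u,v)}" using M e by (simp add: broder_move_def)
  have "card (M - {(u,v)}) + 1 = card (lverts G)" using M G e fin card_Suc_Diff1[of M] by (auto simp: perfect_iff)
  moreover have "fst ` (M - {(u,v)}) = fst ` M - {u}" "snd ` (M - {(u,v)}) = snd ` M - {v}"
    using matchingD[OF m e] matchingD[OF m _ e] e by (force simp: image_iff)+
  moreover have "M - {(u,v)} \<in> matchings G" using m unfolding matchings_def by auto
  moreover have "u \<in> fst ` M" "v \<in> snd ` M" using e by force+
  ultimately show "M - {(u,v)} \<in> near_perfect_matchings_at G u v"
    using M unfolding near_perfect_matchings_at_def near_perfect_matchings_def perfect_matchings_def by auto
  show "(u,v) \<in> edges G" using m e unfolding matchings_def by auto
qed

lemma add_in: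
  assumes G: "bigraph G" and M: "M \<in> near_perfect_matchings_at G u v" and e: "(u,v) \<in> edges G"
  shows "broder_move G M (u,v) = insert (u,v) M" "insert (u,v) M \<in> perfect_matchings G" "(u,v) \<notin> M"
proof -
  have m: "M \<in> matchings G" and n: "M \<in> near_perfect_matchings G" and fin: "finite M" using M finite_states[OF G]
    unfolding near_perfect_matchings_at_def near_perfect_matchings_def matchings_def by (auto intro: finite_subset)
  have np: "M \<notin> perfect_matchings G" using n G by (auto simp: perfect_iff near_perfect_matchings_def)
  have u: "u \<notin> fst ` M" and v: "v \<notin> snd ` M" using M unfolding near_perfect_matchings_at_def by auto
  show uv: "(u,v) \<notin> M" using u by force
  show "broder_move G M (u,v) = insert (u,v) M" using M np by (simp add: broder_move_def)
  have "insert (u,v) M \<in> matchings G" using m u v e unfolding matchings_def by (auto simp: rev_image_eqI)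
  moreover have "card (insert (u,v) M) = card (lverts G)" using n uv fin by (simp add: near_perfect_matchings_def)
  ultimately show "insert (u,v) M \<in> perfect_matchings G" using G by (simp add: perfect_iff)
qed

text \<open>Moves stay within the states, and every proper move is undone by a unique edge.\<close>

lemma move_cases:
  assumes G: "bigraph G" and M: "M \<in> states G" and e: "e \<in> edges G"
  shows "broder_move G M e \<in> states G \<and> (broder_move G M e = M \<or>
     (\<exists>e'\<in>edges G. broder_move G (broder_move G M e) e' = M \<and>
        (e' = e \<and> (broder_move G M e = M - {e} \<and> e \<in> M \<or> broder_move G M e = insert e M \<and> e \<notin> M) \<or>
         e \<notin> M \<and> e' \<in> M \<and> broder_move G M e = insert e (M - {e'}))))"
proof -
  obtain u v where uv: "e = (u,v)" by fastforce
  consider (a) "M \<in> perfect_matchings G" "(u,v) \<in> M" | (b) "M \<in> near_perfect_matchings_at G u v"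
   | (c) "M \<in> near_perfect_matchings G" "u \<notin> fst ` M" "v \<in> snd ` M"
   | (d) "M \<in> near_perfect_matchings G" "u \<in> fst ` M" "v \<notin> snd ` M"
   | (f) "broder_move G M e = M" unfolding broder_move_def uv prod.case by (cases "M \<in> perfect_matchings G \<and> (u, v) \<in> M"; simp) (smt (verit))
  then show ?thesis
  proof cases
    case a
    note r = remove_in[OF G a]
    have "insert (u,v) (M - {(u,v)}) = M" using a by auto
    then show ?thesis using r add_in(1)[OF G r(2,3)] a uv by (auto simp: states_def near_perfect_matchings_at_def)
  next
    case b
    note r = add_in[OF G b e[unfolded uv]]
    have "insert (u,v) M - {(u,v)} = M" using r by auto
    then show ?thesis using r remove_in(1)[OF G r(2), of u v] uv e by (auto simp: states_def)
  next
    case c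
    then obtain u' where e': "(u',v) \<in> M" by auto
    note r = slide_in[OF G c(1) e[unfolded uv] c(2) e']
    have nn: "(u,v) \<notin> M" using c by force
    have "broder_move G (insert (u,v) (M - {(u',v)})) (u',v) = M"
      using slide_in(1)[OF G r(2,3,4,5)] r(6) by simp
    then show ?thesis unfolding uv r(1) using r(2,3) e' nn unfolding states_def by blast
  next
    case d
    then obtain v' where e': "(u,v') \<in> M" by auto
    note r = slide_in2[OF G d(1) e[unfolded uv] d(3) e']
    have nn: "(u,v) \<notin> M" using d by force
    have "broder_move G (insert (u,v) (M - {(u,v')})) (u,v') = M"
      using slide_in2(1)[OF G r(2,3,4,5)] r(6) by simp
    then show ?thesis unfolding uv r(1) using r(2,3) e' nn unfolding states_def by blast
  next
    case f then show ?thesis using M by simp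
  qed
qed

lemma card_moves_sym:
  assumes G: "bigraph G" and x: "x \<in> states G" and y: "y \<in> states G"
  shows "card {e\<in>edges G. broder_move G x e = y} = card {e\<in>edges G. broder_move G y e = x}"
proof (cases "x = y")
  case False
  have le: "card {e\<in>edges G. broder_move G x e = y} \<le> 1" if "x \<in> states G" "x \<noteq> y" for x y
  proof -
    have "e = f" if "e \<in> {e\<in>edges G. broder_move G x e = y}" "f \<in> {e\<in>edges G. broder_move G x e = y}" for e f
      using move_cases[OF G \<open>x \<in> states G\<close>, of e] move_cases[OF G \<open>x \<in> states G\<close>, of f] that \<open>x \<noteq> y\<close> by blast
    then show ?thesis by (metis (no_types, lifting) card_le_Suc0_iff_eq One_nat_def finite_states(2)[OF G] finite_Collect_conjI finite.intros(1) card.infinite zero_le Collect_mem_eq)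
  qed
  have ne: "{e\<in>edges G. broder_move G y e = x} \<noteq> {}" if "{e\<in>edges G. broder_move G x e = y} \<noteq> {}" "x \<in> states G" "x \<noteq> y" for x y
    using that move_cases[OF G \<open>x \<in> states G\<close>] by blast
  have f: "finite {e\<in>edges G. broder_move G x e = y}" for x y using finite_states(2)[OF G] by simp
  have "card {e\<in>edges G. broder_move G x e = y} = 0 \<longleftrightarrow> card {e\<in>edges G. broder_move G y e = x} = 0"
    using ne[of x y] ne[of y x] x y False f by (auto simp: card_eq_0_iff simp del: Collect_empty_eq empty_Collect_eq)
  then show ?thesis using le[OF x False] le[OF y False[symmetric]] by linarith
qed simp

lemma pmf_step:
  assumes "bigraph G" "edges G \<noteq> {}"
  shows "pmf (broder_step G x) y = (if x = y then 1/2 else 0) + card {e\<in>edges G. broder_move G x e = y} / (2 * card (edges G))"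
proof -
  have "pmf (map_pmf (broder_move G x) (pmf_of_set (edges G))) y = card {e\<in>edges G. broder_move G x e = y} / card (edges G)"
    using assms finite_states(2)[OF assms(1)] by (simp add: pmf_map measure_pmf_of_set vimage_def Int_def)
  then show ?thesis unfolding broder_step_def by (simp add: pmf_bind integral_bernoulli_pmf indicator_def)
qed

lemma stationary_invariant:
  assumes G: "bigraph G" "edges G \<noteq> {}" "states G \<noteq> {}"
  shows "bind_pmf (stationary G) (broder_step G) = stationary G"
proof (rule pmf_eqI)
  fix y
  note f = finite_states[OF G(1)]
  have [simp]: "set_pmf (pmf_of_set (edges G)) = edges G" using f G by (simp add: set_pmf_of_set)
  have "pmf (bind_pmf (stationary G) (broder_step G)) y = (\<Sum>x\<in>states G. pmf (broder_step G x) y) / card (states G)"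
    unfolding stationary_def using f G by (simp add: pmf_bind integral_pmf_of_set)
  also have "\<dots> = pmf (stationary G) y"
  proof (cases "y \<in> states G")
    case True
    have sub: "set_pmf (broder_step G y) \<subseteq> states G"
      using True move_cases[OF G(1) True] f G by (fastforce simp: broder_step_def split: if_splits)
    have "(\<Sum>x\<in>states G. pmf (broder_step G x) y) = (\<Sum>x\<in>states G. pmf (broder_step G y) x)"
      by (rule sum.cong) (use True card_moves_sym[OF G(1)] G in \<open>auto simp: pmf_step\<close>)
    also have "\<dots> = 1" using sum_pmf_eq_1[OF f(1) sub] .
    finally show ?thesis using True f G by (simp add: stationary_def)
  next
    case False
    have "pmf (broder_step G x) y = 0" if "x \<in> states G" for x
      using False that move_cases[OF G(1) that] f G by (auto simp: broder_step_def pmf_eq_0_set_pmf split: if_splits)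
    then show ?thesis using False f G by (simp add: stationary_def)
  qed
  finally show "pmf (bind_pmf (stationary G) (broder_step G)) y = pmf (stationary G) y" .
qed

end

(*
A set S of at most half of the states from which only few states have a move out of S takes the
chain a time of order |S| / |frontier of S| to leave, so exponentially thin frontiers rule out
polynomial mixing.

Threshold graphs: in the graph with edges u_i v_j (j <= i < n), a state is determined by the set P
of all i with u_i v_i unmatched, and every subset P of {..<n} occurs. The holes are at u_(min P) and
v_(max P), and a move can only add or remove an element at one end of P. Hence membership of the
middle index is frozen unless one half of {..<n} is disjoint from P.

Other classes: join two vertices by r chains of k copies of a small cell that has at least twice
as many perfect matchings as matchings missing exactly its two ports. The matching inside the middle
cell of a chain can only change if the state is perfect or a hole is next to this cell, and then
about k/2 cells are traversed by an alternating path, which costs a factor 2 each. With K_{2,2} as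
cell the graph is planar for r = 1 and Hamiltonian for r = 2; with K_{3,3} minus an edge as cell and
r = 3 it is cubic.
*)

theory Submission
  imports Defs "HOL-Real_Asymp.Real_Asymp"
begin

section \<open>Bottlenecks\<close>

text \<open>Why the frontier is thin in the second construction: let A be the number of perfect
  matchings of a cell. If both hubs are holes, all \<open>r * k\<close> cells can be matched
  internally and independently, which gives A^(r k) states. A cell crossed by an alternating path
  has its two ports matched outside and at most A/2 completions, so states with such a path through
  w cells are fewer by about 2^w. A perfect matching has to match the hubs and therefore contains a
  path through a whole chain, so these states are rare; near-perfect ones with a hole next to the
  middle cell are rare for the same reason. The set S is given by one fixed matching of the middle
  cell. As A is at least 2, there are two disjoint candidates for S, and one of them has at most
  half of the states. A hole inside a cell spoils the count there, but there is at most one hole per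
  side, so this costs a constant factor, and the positions of the holes cost a polynomial
  one.\<close>

lemma vdegree_Inl: "vdegree G (Inl u) = card {v. (u, v) \<in> edges G}"
proof -
  have "{y. adjacent G (Inl u) y} = Inr ` {v. (u, v) \<in> edges G}"
    by (force simp: adjacent_def)
  then show ?thesis by (simp add: vdegree_def card_image)
qed

lemma vdegree_Inr: "vdegree G (Inr v) = card {u. (u, v) \<in> edges G}"
proof -
  have "{y. adjacent G (Inr v) y} = Inl ` {u. (u, v) \<in> edges G}"
    by (force simp: adjacent_def)
  then show ?thesis by (simp add: vdegree_def card_image)
qed

text \<open>A matching has at most as many edges as there are left vertices, so size at least n - 1
  leaves exactly the perfect and the near-perfect ones. The additive form avoids subtraction on
  \<open>nat\<close>.\<close>

lemma states_iff:
  assumes "bigraph G"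
  shows "M \<in> states G \<longleftrightarrow> M \<in> matchings G \<and> card (lverts G) \<le> card M + 1"
proof -
  have "card M \<le> card (lverts G)" if M: "M \<in> matchings G"
  proof -
    have "fst ` M \<subseteq> lverts G" using M assms by (auto simp: matchings_def bigraph_def)
    then have "card (fst ` M) \<le> card (lverts G)" using assms by (intro card_mono) (auto simp: bigraph_def)
    then show ?thesis using card_matching(1)[OF M] by simp
  qed
  then show ?thesis
    by (auto simp: states_def perfect_iff[OF assms] near_perfect_matchings_def)
qed

lemma card_unmatched:
  assumes G: "bigraph G" and M: "M \<in> matchings G"
  shows "card (lverts G - fst ` M) = card (lverts G) - card M"
    "card (rverts G - snd ` M) = card (lverts G) - card M"
proof -
  have s: "fst ` M \<subseteq> lverts G" "snd ` M \<subseteq> rverts G"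
    using M G by (auto simp: matchings_def bigraph_def)
  then have "finite (fst ` M)" "finite (snd ` M)"
    using G finite_subset unfolding bigraph_def by blast+
  then show "card (lverts G - fst ` M) = card (lverts G) - card M"
    "card (rverts G - snd ` M) = card (lverts G) - card M"
    using s G card_matching[OF M] by (simp_all add: card_Diff_subset bigraph_def)
qed

lemma card_le_one_eq: "\<lbrakk>card A \<le> 1; finite A; x \<in> A; y \<in> A\<rbrakk> \<Longrightarrow> x = y"
  by (simp add: card_le_Suc0_iff_eq)

text \<open>The form in which "at most one hole per side" is used below: a vertex found to be free
  is identified with a free vertex already known.\<close>

lemma unmatched_unique:
  assumes G: "bigraph G" and M: "M \<in> states G"
  shows "\<lbrakk>u \<in> lverts G; u \<notin> fst ` M; u' \<in> lverts G; u' \<notin> fst ` M\<rbrakk> \<Longrightarrow> u = u'"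
    "\<lbrakk>v \<in> rverts G; v \<notin> snd ` M; v' \<in> rverts G; v' \<notin> snd ` M\<rbrakk> \<Longrightarrow> v = v'"
proof -
  have "card (lverts G - fst ` M) \<le> 1" "card (rverts G - snd ` M) \<le> 1"
    using M card_unmatched[OF G] by (auto simp: states_iff[OF G])
  moreover have "finite (lverts G - fst ` M)" "finite (rverts G - snd ` M)"
    using G by (auto simp: bigraph_def)
  ultimately show "\<lbrakk>u \<in> lverts G; u \<notin> fst ` M; u' \<in> lverts G; u' \<notin> fst ` M\<rbrakk> \<Longrightarrow> u = u'"
    "\<lbrakk>v \<in> rverts G; v \<notin> snd ` M; v' \<in> rverts G; v' \<notin> snd ` M\<rbrakk> \<Longrightarrow> v = v'"
    by (auto simp: card_le_Suc0_iff_eq)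
qed

section \<open>Escape from a set of states through its frontier\<close>

definition frontier_states :: "('a, 'b) bigraph \<Rightarrow> ('a \<times> 'b) set set \<Rightarrow> ('a \<times> 'b) set set" where
  "frontier_states G S = {M \<in> S. \<exists>e\<in>edges G. broder_move G M e \<notin> S}"

lemma broder_dist_0 [simp]: "broder_dist G 0 x = return_pmf x"
  by (simp add: broder_dist_def)

lemma broder_dist_Suc: "broder_dist G (Suc t) x = bind_pmf (broder_dist G t x) (broder_step G)"
  by (simp add: broder_dist_def)

lemma stationary_broder_dist:
  assumes "bigraph G" "edges G \<noteq> {}" "states G \<noteq> {}"
  shows "bind_pmf (stationary G) (broder_dist G t) = stationary G"
proof (induction t)
  case 0
  then show ?case by (simp add: bind_return_pmf')
next
  case (Suc t)
  then show ?case
    using stationary_invariant[OF assms] by (simp add: broder_dist_Suc bind_assoc_pmf[symmetric])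
qed

text \<open>Invariance of the uniform distribution bounds the column sums of the t-step transition
  matrix by 1: the sum over all starts is the number of states times the mass that a uniform start
  puts on \<open>y\<close>. Starts outside \<open>S\<close> only add to it.\<close>

lemma sum_broder_dist_le:
  assumes "bigraph G" "edges G \<noteq> {}" "states G \<noteq> {}" "S \<subseteq> states G"
  shows "(\<Sum>x\<in>S. pmf (broder_dist G t x) y) \<le> 1"
proof -
  note f = finite_states(1)[OF assms(1)]
  have "(\<Sum>x\<in>states G. pmf (broder_dist G t x) y) / card (states G)
      = pmf (bind_pmf (stationary G) (broder_dist G t)) y"
    unfolding stationary_def using f assms by (simp add: pmf_bind integral_pmf_of_set)
  also have "\<dots> \<le> 1 / card (states G)"
    unfolding stationary_broder_dist[OF assms(1-3)] using f assms
    by (simp add: stationary_def indicator_def)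
  finally have "(\<Sum>x\<in>states G. pmf (broder_dist G t x) y) \<le> 1"
    using f assms by (simp add: divide_le_cancel card_gt_0_iff)
  moreover have "(\<Sum>x\<in>S. pmf (broder_dist G t x) y) \<le> (\<Sum>x\<in>states G. pmf (broder_dist G t x) y)"
    using f assms by (intro sum_mono2) auto
  ultimately show ?thesis by simp
qed

text \<open>Mass leaves \<open>S\<close> only from frontier states. Added over all starts in
  \<open>S\<close>, a frontier state carries mass at most 1 at any time, so each step lets out at
  most one unit per frontier state.\<close>

lemma escape_le:
  assumes G: "bigraph G" "edges G \<noteq> {}" "states G \<noteq> {}" "S \<subseteq> states G"
  shows "(\<Sum>x\<in>S. measure_pmf.prob (broder_dist G t x) (- S)) \<le> t * card (frontier_states G S)"
proof (induction t)
  case 0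
  then show ?case by (simp add: indicator_def)
next
  case (Suc t)
  let ?B = "frontier_states G S"
  have finS: "finite S" using finite_states(1)[OF G(1)] G(4) finite_subset by blast
  have finB: "finite ?B" using finS by (simp add: frontier_states_def)
  \<comment> \<open>Mass already outside \<open>S\<close> is counted as staying outside and a
    frontier state as losing everything, which gives an upper bound without transition
    probabilities.\<close>
  have step: "measure_pmf.prob (broder_step G y) (- S) \<le> indicator (- S) y + indicator ?B y" for y
  proof (cases "y \<in> S - ?B")
    case True
    have "set_pmf (pmf_of_set (edges G)) = edges G"
      using finite_states(2)[OF G(1)] G(2) by (simp add: set_pmf_of_set)
    then have "set_pmf (broder_step G y) \<subseteq> S"
      using True by (auto simp: broder_step_def frontier_states_def split: if_splits)
    then have "measure_pmf.prob (broder_step G y) (- S) = 0"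
      by (auto simp: measure_pmf_zero_iff)
    then show ?thesis by simp
  next
    case False
    then have "indicator (- S) y + indicator ?B y \<ge> (1::real)" by (auto simp: indicator_def)
    then show ?thesis using measure_pmf.prob_le_1 order_trans by blast
  qed
  have one: "measure_pmf.prob (broder_dist G (Suc t) x) (- S)
      \<le> measure_pmf.prob (broder_dist G t x) (- S) + measure_pmf.prob (broder_dist G t x) ?B" for x
  proof -
    let ?p = "broder_dist G t x"
    have "measure_pmf.prob (broder_dist G (Suc t) x) (- S)
        = measure_pmf.expectation ?p (\<lambda>y. measure_pmf.prob (broder_step G y) (- S))"
      unfolding broder_dist_Suc measure_pmf_bind
      by (intro measure_pmf.measure_bind[where N="count_space UNIV"])
        (auto simp: measurable_def space_subprob_algebra intro: prob_space_imp_subprob_space measure_pmf.prob_space_axioms)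
    also have "\<dots> \<le> measure_pmf.expectation ?p (\<lambda>y. indicator (- S) y + indicator ?B y)"
      by (intro integral_mono step measure_pmf.integrable_const_bound[where B=1]
          Bochner_Integration.integrable_add) (auto simp: indicator_def)
    also have "\<dots> = measure_pmf.prob ?p (- S) + measure_pmf.prob ?p ?B"
      by (subst Bochner_Integration.integral_add)
        (auto intro!: measure_pmf.integrable_const_bound[where B=1] simp: integral_indicator)
    finally show ?thesis .
  qed
  have "(\<Sum>x\<in>S. measure_pmf.prob (broder_dist G t x) ?B)
      = (\<Sum>y\<in>?B. \<Sum>x\<in>S. pmf (broder_dist G t x) y)"
    by (subst sum.swap) (simp add: measure_measure_pmf_finite[OF finB])
  also have "\<dots> \<le> (\<Sum>y\<in>?B. 1)"
    by (intro sum_mono sum_broder_dist_le G)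
  finally have "(\<Sum>x\<in>S. measure_pmf.prob (broder_dist G t x) ?B) \<le> card ?B" by simp
  moreover have "(\<Sum>x\<in>S. measure_pmf.prob (broder_dist G (Suc t) x) (- S))
      \<le> (\<Sum>x\<in>S. measure_pmf.prob (broder_dist G t x) (- S))
        + (\<Sum>x\<in>S. measure_pmf.prob (broder_dist G t x) ?B)"
    unfolding sum.distrib[symmetric] by (intro sum_mono one)
  ultimately show ?case using Suc.IH by (simp add: algebra_simps)
qed

text \<open>\<open>stationary G\<close> gives the complement of \<open>S\<close> mass at least 1/2,
  so within distance 1/4 of it every start in \<open>S\<close> must have escaped with probability at
  least 1/4; \<open>escape_le\<close> bounds the total of these probabilities.\<close>

lemma bottleneck:
  assumes G: "bigraph G" "edges G \<noteq> {}" and S: "S \<subseteq> states G" "S \<noteq> {}"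
    and half: "2 * card S \<le> card (states G)" and t: "max_distance G t \<le> 1/4"
  shows "real (card S) \<le> 4 * t * card (frontier_states G S)"
proof -
  note f = finite_states(1)[OF G(1)]
  have ne: "states G \<noteq> {}" using S by auto
  have fS: "finite S" using f S finite_subset by blast
  have cpos: "card (states G) > 0" using f ne by (simp add: card_gt_0_iff)
  have esc: "measure_pmf.prob (broder_dist G t x) (- S) \<ge> 1/4" if x: "x \<in> S" for x
  proof -
    let ?p = "broder_dist G t x" and ?\<pi> = "stationary G"
    let ?q = "real (card S) / card (states G)"
    have pi: "pmf ?\<pi> y = 1 / card (states G)" if "y \<in> states G" for y
      using that f ne by (simp add: stationary_def)
    have "1/2 * (\<Sum>y\<in>states G. \<bar>pmf ?\<pi> y - pmf ?p y\<bar>) \<le> max_distance G t"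
      unfolding max_distance_def using f x S by (intro Max_ge) auto
    then have le: "(\<Sum>y\<in>states G. \<bar>pmf ?\<pi> y - pmf ?p y\<bar>) \<le> 1/2" using t by simp
    have split: "(\<Sum>y\<in>states G. \<bar>pmf ?\<pi> y - pmf ?p y\<bar>) =
       (\<Sum>y\<in>states G - S. \<bar>pmf ?\<pi> y - pmf ?p y\<bar>) + (\<Sum>y\<in>S. \<bar>pmf ?\<pi> y - pmf ?p y\<bar>)"
      by (rule sum.subset_diff[OF S(1) f])
    \<comment> \<open>Both parts of the split sum are at least 1/2 minus the probability of
      \<open>- S\<close>, and together they are at most 1/2.\<close>
    have "(\<Sum>y\<in>S. \<bar>pmf ?\<pi> y - pmf ?p y\<bar>) \<ge> (\<Sum>y\<in>S. pmf ?p y - pmf ?\<pi> y)"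
      by (intro sum_mono) auto
    moreover have "(\<Sum>y\<in>S. pmf ?p y - pmf ?\<pi> y) = measure_pmf.prob ?p S - ?q"
      using S pi by (simp add: sum_subtractf measure_measure_pmf_finite[OF fS] subset_iff)
    moreover have "measure_pmf.prob ?p S = 1 - measure_pmf.prob ?p (- S)"
      using measure_pmf.prob_compl[of "- S" ?p] by (simp add: Compl_eq_Diff_UNIV double_diff)
    moreover have "(\<Sum>y\<in>states G - S. \<bar>pmf ?\<pi> y - pmf ?p y\<bar>) \<ge> (\<Sum>y\<in>states G - S. pmf ?\<pi> y - pmf ?p y)"
      by (intro sum_mono) auto
    moreover have "(\<Sum>y\<in>states G - S. pmf ?\<pi> y - pmf ?p y) =
        real (card (states G - S)) / card (states G) - measure_pmf.prob ?p (states G - S)"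
      using pi f by (simp add: sum_subtractf measure_measure_pmf_finite)
    moreover have "measure_pmf.prob ?p (states G - S) \<le> measure_pmf.prob ?p (- S)"
      by (intro measure_pmf.finite_measure_mono) auto
    moreover have "real (card (states G - S)) / card (states G) = 1 - ?q"
      using f S ne fS cpos card_mono[OF f S(1)] by (simp add: card_Diff_subset of_nat_diff diff_divide_distrib)
    moreover have "?q \<le> 1/2" using half cpos by (simp add: field_simps)
    ultimately show ?thesis using le split by linarith
  qed
  have "real (card S) * (1/4) = (\<Sum>x\<in>S. 1/4)" by simp
  also have "\<dots> \<le> (\<Sum>x\<in>S. measure_pmf.prob (broder_dist G t x) (- S))"
    by (intro sum_mono esc)
  also have "\<dots> \<le> t * card (frontier_states G S)"
    by (rule escape_le[OF G ne S(1)])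
  finally show ?thesis by simp
qed

section \<open>From a polynomial mixing time to a contradiction\<close>

text \<open>Coefficients of \<open>p\<close> may be negative, so \<open>poly p\<close> need not be
  monotone; \<open>K * (1 + x) ^ D\<close> is, and it can be evaluated at an upper bound on the
  number of vertices.\<close>

lemma poly_le_power:
  fixes p :: "real poly"
  obtains K D where "K \<ge> 0" "\<And>x. x \<ge> 0 \<Longrightarrow> poly p x \<le> K * (1 + x) ^ D"
proof -
  have "\<exists>K D. K \<ge> 0 \<and> (\<forall>x\<ge>0. poly p x \<le> K * (1 + x) ^ D)"
  proof (induction p)
    case 0
    then show ?case by (intro exI[of _ 0]) auto
  next
    case (pCons a p)
    then obtain K D where K: "K \<ge> 0" "\<And>x. x \<ge> 0 \<Longrightarrow> poly p x \<le> K * (1 + x) ^ D" by blast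
    have "poly (pCons a p) x \<le> (\<bar>a\<bar> + K) * (1 + x) ^ Suc D" if x: "x \<ge> 0" for x
    proof -
      have "x * poly p x \<le> (1 + x) * (K * (1 + x) ^ D)"
        using K(2)[OF x] K(1) x mult_left_mono[of "poly p x" "K * (1 + x) ^ D" x]
        by (smt (verit) mult_right_mono zero_le_mult_iff zero_le_power)
      moreover have "a \<le> \<bar>a\<bar> * (1 + x) ^ Suc D"
        using x one_le_power[of "1 + x" "Suc D"] mult_left_mono[of 1 "(1 + x) ^ Suc D" "\<bar>a\<bar>"] by auto
      ultimately show ?thesis by (simp add: algebra_simps)
    qed
    then show ?case using K(1) by (intro exI[of _ "\<bar>a\<bar> + K"] exI[of _ "Suc D"]) auto
  qed
  then show ?thesis using that by blast
qed

lemma power_less_exp2: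
  fixes K :: real
  shows "\<exists>k::nat. K * (real k + 1) ^ D < 2 ^ k"
proof -
  have "((\<lambda>k::nat. K * (real k + 1) ^ D / 2 ^ k) \<longlongrightarrow> 0) sequentially"
    by real_asymp
  then have "eventually (\<lambda>k. K * (real k + 1) ^ D / 2 ^ k < 1) sequentially"
    by (rule order_tendstoD) simp
  then show ?thesis by (auto simp: eventually_sequentially)
qed

lemma card_states_le:
  assumes "bigraph G" shows "card (states G) \<le> 2 ^ (card (lverts G) ^ 2)"
proof -
  have "states G \<subseteq> Pow (lverts G \<times> rverts G)"
    using assms by (auto simp: states_def perfect_matchings_def near_perfect_matchings_def
        matchings_def bigraph_def)
  moreover have "finite (lverts G \<times> rverts G)" using assms by (simp add: bigraph_def)
  ultimately have "card (states G) \<le> card (Pow (lverts G \<times> rverts G))"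
    by (intro card_mono) auto
  then show ?thesis using assms by (simp add: bigraph_def card_Pow card_cartesian_product power2_eq_square)
qed

text \<open>The accuracy is fixed at 1/4. \<open>pi_min G\<close> is the inverse of the number of
  states, which is at most 2^(n^2), so both logarithms together are at most 4 (1 + n)^2: this
  accounts for the factor 4 and the increase of the exponent by 2.\<close>

lemma rapidly_mixing_onD:
  assumes "rapidly_mixing_on \<GG>"
  obtains K D where "K \<ge> 0" "\<And>G. G \<in> \<GG> \<Longrightarrow> bigraph G \<Longrightarrow> lverts G \<noteq> {} \<Longrightarrow> perfect_matchings G \<noteq> {} \<Longrightarrow>
     \<exists>t. max_distance G t \<le> 1/4 \<and> real t \<le> K * (1 + real (card (lverts G))) ^ D"
proof -
  obtain p :: "real poly" where p: "\<And>G n \<epsilon>. G \<in> \<GG> \<Longrightarrow> card (lverts G) = n \<Longrightarrow> n \<ge> 1 \<Longrightarrow>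
       perfect_matchings G \<noteq> {} \<Longrightarrow> 0 < \<epsilon> \<Longrightarrow> \<epsilon> < 1 \<Longrightarrow>
     ereal_of_enat (mixing_time G \<epsilon>) \<le>
       ereal (poly p (real n) * (ln (1 / \<epsilon>) + ln (1 / pi_min G)))"
    using assms unfolding rapidly_mixing_on_def by blast
  obtain K D where K: "K \<ge> 0" "\<And>x. x \<ge> 0 \<Longrightarrow> poly p x \<le> K * (1 + x) ^ D"
    using poly_le_power[of p] by blast
  show thesis
  proof (rule that)
    show "K * 4 \<ge> 0" using K by simp
    fix G assume G: "G \<in> \<GG>" "bigraph G" "lverts G \<noteq> {}" "perfect_matchings G \<noteq> {}"
    define n where "n = card (lverts G)"
    have n1: "n \<ge> 1" using G by (auto simp: n_def bigraph_def Suc_le_eq card_gt_0_iff)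
    have ne: "states G \<noteq> {}" using G by (auto simp: states_def)
    note f = finite_states(1)[OF G(2)]
    have cpos: "card (states G) > 0" using f ne by (simp add: card_gt_0_iff)
    have "pmf (stationary G) ` states G = {1 / card (states G)}"
      using f ne by (auto simp: stationary_def image_iff)
    then have pm: "1 / pi_min G = card (states G)" by (simp add: pi_min_def)
    have "ln (real (card (states G))) \<le> ln (2 ^ (n^2))"
      using card_states_le[OF G(2)] cpos unfolding n_def[symmetric]
      by (subst ln_le_cancel_iff) (auto simp flip: of_nat_power of_nat_le_iff)
    also have "\<dots> = n^2 * ln 2" by (simp add: ln_realpow)
    also have "\<dots> \<le> n^2" using ln_le_minus_one[of "2::real"] by (simp add: mult_left_le)
    finally have l1: "ln (real (card (states G))) \<le> n^2" by simp
    have "ln (4::real) \<le> 3" using ln_le_minus_one[of "4::real"] by simp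
    then have "ln (1 / (1/4)) + ln (1 / pi_min G) \<le> 4 * (1 + real n)^2"
    proof -
      have "4 * (1 + real n)^2 = 4 + 8 * real n + 4 * (real n)^2"
        by (simp add: power2_eq_square algebra_simps)
      moreover have "0 \<le> real n" "0 \<le> (real n)^2" by auto
      moreover have "ln (1 / (1/4)) = ln (4::real)" by simp
      ultimately show ?thesis
        using l1 \<open>ln (4::real) \<le> 3\<close> unfolding pm of_nat_power by linarith
    qed
    moreover have "ln (1 / (1/4)) + ln (1 / pi_min G) \<ge> 0"
      using cpos unfolding pm by (simp add: ln_ge_zero Suc_le_eq)
    ultimately have "poly p n * (ln (1 / (1/4)) + ln (1 / pi_min G)) \<le> (K * (1 + real n) ^ D) * (4 * (1 + real n)^2)"
      using K(2)[of n] K(1) mult_right_mono[of "poly p n" "K * (1 + real n) ^ D"]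
        mult_left_mono[of _ "4 * (1 + real n)^2" "K * (1 + real n) ^ D"]
      by (meson of_nat_0_le_iff add_nonneg_nonneg mult_nonneg_nonneg order_trans zero_le_one zero_le_power)
    also have "\<dots> = K * 4 * (1 + real n) ^ (D + 2)" by (simp add: power_add power2_eq_square)
    finally have rhs: "poly p n * (ln (1 / (1/4)) + ln (1 / pi_min G)) \<le> K * 4 * (1 + real n) ^ (D + 2)" .
    have mt: "ereal_of_enat (mixing_time G (1/4)) \<le> ereal (K * 4 * (1 + real n) ^ (D + 2))"
      using p[OF G(1) n_def[symmetric] n1 G(4), of "1/4"] rhs
      by (meson ereal_less_eq(3) order_trans divide_less_eq_1 zero_less_divide_iff zero_less_numeral one_less_numeral_iff semiring_norm(76) zero_less_one)
    then obtain t where t: "mixing_time G (1/4) = enat t"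
      by (cases "mixing_time G (1/4)") auto
    \<comment> \<open>An empty set would have infimum \<infinity>; otherwise the infimum in
      \<open>enat\<close> is attained, which yields an actual time \<open>t\<close>.\<close>
    have "enat ` {t. max_distance G t \<le> 1/4} \<noteq> {}"
    proof
      assume "enat ` {t. max_distance G t \<le> 1/4} = {}"
      then have "mixing_time G (1/4) = \<infinity>" by (simp add: mixing_time_def Inf_enat_def)
      then show False using t by simp
    qed
    then have "mixing_time G (1/4) \<in> enat ` {t. max_distance G t \<le> 1/4}"
      unfolding mixing_time_def by (meson wellorder_InfI ex_in_conv)
    then have "max_distance G t \<le> 1/4" using t by auto
    moreover have "real t \<le> K * 4 * (1 + real n) ^ (D + 2)" using mt t by simp
    ultimately show "\<exists>t. max_distance G t \<le> 1/4 \<and> real t \<le> K * 4 * (1 + real (card (lverts G))) ^ (D + 2)"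
      unfolding n_def by blast
  qed
qed

text \<open>The factor \<open>(k + 1) ^ 2\<close> leaves room for the positions of two holes. Since
  the size is linear in \<open>k\<close>, the gap \<open>2 ^ k\<close> outgrows every polynomial in
  the size.\<close>

lemma not_rapidly_mixingI:
  fixes G :: "nat \<Rightarrow> ('a, 'b) bigraph" and C c :: nat
  assumes G: "\<And>k. G k \<in> \<GG>" "\<And>k. bigraph (G k)" "\<And>k. lverts (G k) \<noteq> {}" "\<And>k. perfect_matchings (G k) \<noteq> {}"
    and size: "\<And>k. card (lverts (G k)) \<le> c * (k + 1)"
    and S: "\<And>k. \<exists>S. S \<subseteq> states (G k) \<and> S \<noteq> {} \<and> 2 * card S \<le> card (states (G k)) \<and>
       card (frontier_states (G k) S) * 2 ^ k \<le> C * (k + 1) ^ 2 * card S"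
  shows "\<not> rapidly_mixing_on \<GG>"
proof
  assume "rapidly_mixing_on \<GG>"
  then obtain K D where K: "K \<ge> 0" "\<And>G. G \<in> \<GG> \<Longrightarrow> bigraph G \<Longrightarrow> lverts G \<noteq> {} \<Longrightarrow> perfect_matchings G \<noteq> {} \<Longrightarrow>
     \<exists>t. max_distance G t \<le> 1/4 \<and> real t \<le> K * (1 + real (card (lverts G))) ^ D"
    by (rule rapidly_mixing_onD) blast
  obtain k :: nat where k: "(4 * C * K * (1 + real c) ^ D) * (real k + 1) ^ (D + 2) < 2 ^ k"
    using power_less_exp2 by blast
  obtain S where S': "S \<subseteq> states (G k)" "S \<noteq> {}" "2 * card S \<le> card (states (G k))"
       "card (frontier_states (G k) S) * 2 ^ k \<le> C * (k + 1) ^ 2 * card S"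
    using S by blast
  obtain t where t: "max_distance (G k) t \<le> 1/4" "real t \<le> K * (1 + real (card (lverts (G k)))) ^ D"
    using K(2)[OF G] by blast
  have e: "edges (G k) \<noteq> {}"
    using G(3,4)[of k] by (auto simp: perfect_matchings_def matchings_def)
  have pos: "card S > 0" using S' finite_states(1)[OF G(2)[of k]] finite_subset by (auto simp: card_gt_0_iff)
  have "real (card S) * 2 ^ k \<le> 4 * t * (card (frontier_states (G k) S) * 2 ^ k)"
    using bottleneck[OF G(2) e S'(1-3) t(1)] by (simp add: mult_right_mono flip: mult.assoc)
  also have "\<dots> \<le> 4 * t * (C * (k + 1) ^ 2 * card S)"
    using S'(4) by (intro of_nat_mono mult_left_mono) auto
  finally have ub: "2 ^ k \<le> 4 * real t * (C * (real k + 1) ^ 2)"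
    using pos by (simp add: algebra_simps)
  have "1 + real (card (lverts (G k))) \<le> (1 + real c) * (real k + 1)"
  proof -
    have "real (card (lverts (G k))) \<le> real (c * (k + 1))" using size of_nat_le_iff by blast
    then show ?thesis by (simp add: algebra_simps)
  qed
  then have "(1 + real (card (lverts (G k)))) ^ D \<le> ((1 + real c) * (real k + 1)) ^ D"
    by (intro power_mono) auto
  then have "real t \<le> K * ((1 + real c) * (real k + 1)) ^ D"
    using t(2) K(1) by (meson mult_left_mono order_trans)
  then have "4 * real t * (C * (real k + 1) ^ 2) \<le> 4 * (K * ((1 + real c) * (real k + 1)) ^ D) * (C * (real k + 1) ^ 2)"
    by (intro mult_right_mono mult_left_mono) auto
  also have "\<dots> = (4 * C * K * (1 + real c) ^ D) * (real k + 1) ^ (D + 2)"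
    by (simp add: power_mult_distrib power_add power2_eq_square)
  finally show False using k ub by simp
qed

section \<open>A threshold graph\<close>

text \<open>The half graph. Its biadjacency matrix is lower triangular, which is a Ferrers matrix
  once the rows are reversed; the diagonal is its only perfect matching.\<close>

definition staircase :: "nat \<Rightarrow> (nat, nat) bigraph" where
  "staircase n = \<lparr>lverts = {..<n}, rverts = {..<n}, edges = {(i, j). j \<le> i \<and> i < n}\<rparr>"

lemma staircase_simps [simp]:
  "lverts (staircase n) = {..<n}" "rverts (staircase n) = {..<n}"
  "edges (staircase n) = {(i, j). j \<le> i \<and> i < n}"
  by (simp_all add: staircase_def)

lemma bigraph_staircase: "bigraph (staircase n)"
  by (auto simp: bigraph_def)

lemma sum_edges_weight:
  fixes f g :: "nat \<Rightarrow> int"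
  assumes "E \<subseteq> {..<n} \<times> {..<n}"
  shows "(\<Sum>(i, j)\<in>E. f i + g j)
    = (\<Sum>i<n. int (card {j. (i, j) \<in> E}) * f i) + (\<Sum>j<n. int (card {i. (i, j) \<in> E}) * g j)"
proof -
  have fin: "finite E" using assms finite_subset by blast
  have fe: "finite {j. (i, j) \<in> E}" "finite {j. (j, i) \<in> E}" for i
    using assms by (auto intro: finite_subset[of _ "{..<n}"])
  have 1: "(\<Sum>(i, j)\<in>E. f i) = (\<Sum>i<n. int (card {j. (i, j) \<in> E}) * f i)"
  proof -
    have "E = Sigma {..<n} (\<lambda>i. {j. (i, j) \<in> E})" using assms by auto
    then have "(\<Sum>(i, j)\<in>E. f i) = (\<Sum>(i, j)\<in>Sigma {..<n} (\<lambda>i. {j. (i, j) \<in> E}). f i)" by simp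
    also have "\<dots> = (\<Sum>i<n. \<Sum>j\<in>{j. (i, j) \<in> E}. f i)"
      using fe by (subst sum.Sigma) auto
    finally show ?thesis by simp
  qed
  have 2: "(\<Sum>(i, j)\<in>E. g j) = (\<Sum>j<n. int (card {i. (i, j) \<in> E}) * g j)"
  proof -
    have eq: "prod.swap ` E = Sigma {..<n} (\<lambda>j. {i. (i, j) \<in> E})" using assms by force
    have "(\<Sum>(i, j)\<in>E. g j) = (\<Sum>(j, i)\<in>prod.swap ` E. g j)"
      by (subst sum.reindex) (auto simp: case_prod_beta)
    also have "\<dots> = (\<Sum>j<n. \<Sum>i\<in>{i. (i, j) \<in> E}. g j)"
      unfolding eq using fe by (subst sum.Sigma) auto
    finally show ?thesis by simp
  qed
  show ?thesis unfolding 1[symmetric] 2[symmetric] by (simp add: case_prod_beta sum.distrib)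
qed

text \<open>
  The weight \<open>2 (i - j) + 1\<close> of a pair is positive on the edges of the staircase and negative
  elsewhere, and the total weight of an edge set depends on the degrees only.
\<close>

lemma threshold_staircase: "threshold (staircase n)"
  unfolding threshold_def
proof (intro allI impI)
  fix E' :: "(nat \<times> nat) set"
  assume "E' \<subseteq> lverts (staircase n) \<times> rverts (staircase n)"
    and deg: "\<forall>x\<in>verts (staircase n). vdegree (staircase n\<lparr>edges := E'\<rparr>) x = vdegree (staircase n) x"
  then have E': "E' \<subseteq> {..<n} \<times> {..<n}" by simp
  let ?E = "{(i, j). j \<le> i \<and> i < n}"
  let ?w = "\<lambda>(i, j). (2 * int i + 1) + (- 2 * int j)"
  have E: "?E \<subseteq> {..<n} \<times> {..<n}" by auto
  have fin: "finite E'" "finite ?E" using E E' finite_subset by blast+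
  have "card {j. (i, j) \<in> E'} = card {j. (i, j) \<in> ?E}" if "i < n" for i
    using bspec[OF deg, of "Inl i"] that by (simp add: vdegree_Inl verts_def InlI)
  moreover have "card {i. (i, j) \<in> E'} = card {i. (i, j) \<in> ?E}" if "j < n" for j
    using bspec[OF deg, of "Inr j"] that by (simp add: vdegree_Inr verts_def InrI)
  ultimately have eq: "sum ?w E' = sum ?w ?E"
    unfolding sum_edges_weight[OF E'] sum_edges_weight[OF E] by simp
  have s1: "sum ?w E' = sum ?w (E' \<inter> ?E) + sum ?w (E' - ?E)"
    using sum.Int_Diff[OF fin(1)] .
  have s2: "sum ?w ?E = sum ?w (E' \<inter> ?E) + sum ?w (?E - E')"
    using sum.Int_Diff[OF fin(2), of ?w E'] by (simp add: Int_commute)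
  \<comment> \<open>The weight is odd, hence at most -1 off the staircase and at least 1 on it.
    Equal totals then leave no pair in either difference.\<close>
  have "sum ?w (E' - ?E) \<le> (\<Sum>e\<in>E' - ?E. - 1)"
    using E' by (intro sum_mono) auto
  moreover have "sum ?w (?E - E') \<ge> (\<Sum>e\<in>?E - E'. 1)"
    by (intro sum_mono) auto
  ultimately have "card (E' - ?E) = 0" "card (?E - E') = 0"
    using eq s1 s2 by auto
  then have "E' = ?E" using fin by auto
  then show "E' = edges (staircase n)" by simp
qed

section \<open>Encoding of states by deviating indices\<close>

text \<open>Row \<open>i\<close> can only use columns up to \<open>i\<close>, and the smaller ones
  are taken, by induction, by their own rows.\<close>

lemma staircase_matching_low:
  assumes M: "M \<in> matchings (staircase n)" and sub: "{..<a} \<subseteq> fst ` M" and "i < a"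
  shows "(i, i) \<in> M"
  using \<open>i < a\<close>
proof (induction i rule: less_induct)
  case (less i)
  obtain j where j: "(i, j) \<in> M" using sub less.prems by force
  have "j \<le> i" using j M by (auto simp: matchings_def)
  moreover have "(j, j) \<in> M" if "j < i" using less that by simp
  ultimately have "j = i" using matching_unique(2)[OF M j, of j] by (metis le_neq_implies_less)
  then show ?case using j by simp
qed

text \<open>The mirror image, from the last column downwards: column \<open>i\<close> can only be
  matched to rows from \<open>i\<close> on, and the larger ones are taken.\<close>

lemma staircase_matching_high:
  assumes M: "M \<in> matchings (staircase n)" and sub: "{a<..<n} \<subseteq> snd ` M" and "a < i" "i < n"
  shows "(i, i) \<in> M"
  using \<open>a < i\<close> \<open>i < n\<close>
proof (induction "n - i" arbitrary: i rule: less_induct)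
  case less
  obtain j where j: "(j, i) \<in> M" using sub less.prems by force
  have "i \<le> j" "j < n" using j M by (auto simp: matchings_def)
  moreover have "(j, j) \<in> M" if "i < j" using less that \<open>j < n\<close> by simp
  ultimately have "j = i" using matching_unique(1)[OF M j, of j] by (metis le_neq_implies_less)
  then show ?case using j by simp
qed

definition deviation :: "nat \<Rightarrow> (nat \<times> nat) set \<Rightarrow> nat set" where
  "deviation n M = {i. i < n \<and> (i, i) \<notin> M}"

text \<open>
  Rows are matched from top to bottom: a deviating row can only be matched to an earlier
  deviating column, and at most one of these is still free.
\<close>

lemma deviation_subset:
  assumes M: "M \<in> states (staircase n)" and M': "M' \<in> states (staircase n)"
    and dev: "deviation n M = deviation n M'"
  shows "(i, j) \<in> M \<Longrightarrow> (i, j) \<in> M'"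
proof (induction i arbitrary: j rule: less_induct)
  case (less i)
  have m: "M \<in> matchings (staircase n)" "M' \<in> matchings (staircase n)"
    using M M' by (auto simp: states_iff[OF bigraph_staircase])
  let ?P = "deviation n M"
  have ij: "j \<le> i" "i < n" using less.prems m by (auto simp: matchings_def)
  have diag: "(l, l) \<in> M' \<longleftrightarrow> (l, l) \<in> M" if "l < n" for l
    using dev that by (auto simp: deviation_def)
  show ?case
  proof (cases "j = i")
    case True
    then show ?thesis using diag ij less.prems by simp
  next
    case False
    then have ji: "j < i" using ij by simp
    have iP: "i \<in> ?P" using ij False less.prems matching_unique(1)[OF m(1)] by (auto simp: deviation_def)
    have jP: "j \<in> ?P" using ij False less.prems matching_unique(2)[OF m(1)] by (auto simp: deviation_def)
    \<comment> \<open>\<open>?Q\<close> plays two roles: the deviating rows before \<open>i\<close>,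
      and the deviating columns open to row \<open>i\<close>. \<open>f\<close> maps each matched row
      of \<open>?Q\<close> to its column, again in \<open>?Q\<close>; as at most one row is free, at
      most one column of \<open>?Q\<close> remains for row \<open>i\<close>.\<close>
    let ?Q = "{l \<in> ?P. l < i}"
    define f where "f l = (SOME j. (l, j) \<in> M)" for l
    have un: "l = l'" if "l \<in> ?Q" "l' \<in> ?Q" "l \<notin> fst ` M" "l' \<notin> fst ` M" for l l'
      using unmatched_unique(1)[OF bigraph_staircase M, of l l'] that ij by auto
    have finQ: "finite ?Q" by simp
    let ?R = "?Q \<inter> fst ` M"
    have fM: "(l, f l) \<in> M" if "l \<in> fst ` M" for l
    proof -
      obtain j where "(l, j) \<in> M" using \<open>l \<in> fst ` M\<close> by auto
      then show ?thesis unfolding f_def by (rule someI)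
    qed
    have fQ: "f ` ?R \<subseteq> ?Q"
    proof
      fix y assume "y \<in> f ` ?R"
      then obtain l where l: "l \<in> ?R" "y = f l" by auto
      then have lM: "(l, y) \<in> M" using fM by simp
      have "y \<le> l" using lM m by (auto simp: matchings_def)
      moreover have "(y, y) \<notin> M"
      proof
        assume y: "(y, y) \<in> M"
        then have "y = l" using matching_unique(2)[OF m(1) lM] by blast
        then show False using y l by (simp add: deviation_def)
      qed
      ultimately show "y \<in> ?Q" using l ij by (simp add: deviation_def)
    qed
    have inj: "inj_on f ?R"
      by (rule inj_onI) (metis IntD2 fM matching_unique(2)[OF m(1)])
    have "card (?Q - fst ` M) \<le> 1"
      using un by (auto simp: card_le_Suc0_iff_eq finQ)
    then have "card ?Q \<le> card ?R + 1"
      using card_Diff_subset_Int[of ?Q "fst ` M"] finQ by simp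
    then have "card (?Q - f ` ?R) \<le> 1"
      using fQ finQ inj by (simp add: card_Diff_subset card_image finite_subset)
    then have one: "y = y'" if "y \<in> ?Q" "y \<notin> f ` ?R" "y' \<in> ?Q" "y' \<notin> f ` ?R" for y y'
      by (rule card_le_one_eq[of "?Q - f ` ?R"]) (use that finQ in auto)
    have "j \<notin> f ` ?R"
    proof
      assume "j \<in> f ` ?R"
      then obtain l where l: "l \<in> ?R" "j = f l" by blast
      then have "(l, j) \<in> M" using fM by blast
      then show False using l matching_unique(2)[OF m(1) less.prems] by auto
    qed
    then have jQ: "j \<in> ?Q" "j \<notin> f ` ?R" using jP ji by simp_all
    have "i \<in> fst ` M'"
    proof (rule ccontr)
      assume iM': "i \<notin> fst ` M'"
      txt \<open>Otherwise all earlier rows are matched in \<open>M'\<close>, hence on the diagonal, so \<open>j \<notin> ?P\<close>.\<close>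
      have "l \<in> fst ` M'" if "l < i" for l
        using unmatched_unique(1)[OF bigraph_staircase M', of l i] iM' that ij by auto
      then have "{..<i} \<subseteq> fst ` M'" by blast
      then have "(j, j) \<in> M'" using staircase_matching_low[OF m(2)] ji by blast
      then show False using jP dev by (auto simp: deviation_def)
    qed
    then obtain j' where j': "(i, j') \<in> M'" by auto
    have "j' \<le> i" using j' m by (auto simp: matchings_def)
    moreover have "j' \<noteq> i" using j' iP dev by (auto simp: deviation_def)
    ultimately have j'i: "j' < i" by simp
    have "j' \<in> ?P" using ij j'i j' matching_unique(2)[OF m(2) j', of j'] dev by (auto simp: deviation_def)
    \<comment> \<open>The rows in \<open>?R\<close> have the same columns in \<open>M'\<close> by
      induction, so \<open>j'\<close> is a leftover column too.\<close>
    moreover have "j' \<notin> f ` ?R"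
    proof
      assume "j' \<in> f ` ?R"
      then obtain l where l: "l \<in> ?R" "j' = f l" by blast
      then have "(l, j') \<in> M" using fM by blast
      then have "(l, j') \<in> M'" using less.IH[of l j'] l by blast
      then show False using l matching_unique(2)[OF m(2) j'] by blast
    qed
    ultimately have "j' = j" using one jQ j'i by auto
    then show ?thesis using j' by simp
  qed
qed

lemma inj_on_deviation: "inj_on (deviation n) (states (staircase n))"
  by (rule inj_onI) (auto intro: deviation_subset)

text \<open>For nonempty \<open>P\<close>, each further row of \<open>P\<close> is matched to the
  preceding element of \<open>P\<close>, so row \<open>Min P\<close> and column \<open>Max P\<close>
  stay free.\<close>

definition path_matching :: "nat \<Rightarrow> nat set \<Rightarrow> (nat \<times> nat) set" where
  "path_matching n P = {(i, i) | i. i < n \<and> i \<notin> P} \<union>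
     {(i, j). i \<in> P \<and> j \<in> P \<and> j < i \<and> (\<forall>l\<in>P. \<not> (j < l \<and> l < i))}"

lemma path_matching_in_states:
  assumes P: "P \<subseteq> {..<n}"
  shows "path_matching n P \<in> states (staircase n)"
proof -
  have m: "path_matching n P \<in> matchings (staircase n)"
  proof (rule matchingI)
    show "(i, j) \<in> edges (staircase n)" if "(i, j) \<in> path_matching n P" for i j
      using that P by (auto simp: path_matching_def)
    show "j = j'" if "(i, j) \<in> path_matching n P" "(i', j') \<in> path_matching n P" "i = i'" for i j i' j'
      using that linorder_neqE_nat[of j j'] by (auto simp: path_matching_def)
    show "i = i'" if "(i, j) \<in> path_matching n P" "(i', j') \<in> path_matching n P" "j = j'" for i j i' j'
      using that linorder_neqE_nat[of i i'] by (auto simp: path_matching_def)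
  qed
  have "n \<le> card (path_matching n P) + 1"
  proof -
    have finP: "finite P" using P finite_subset by blast
    \<comment> \<open>If \<open>P\<close> is empty, \<open>Min P\<close> is an arbitrary number;
      this is harmless, as the count allows for one extra element.\<close>
    have "{..<n} \<subseteq> fst ` path_matching n P \<union> {Min P}"
    proof
      fix i assume i: "i \<in> {..<n}"
      show "i \<in> fst ` path_matching n P \<union> {Min P}"
      proof (cases "i \<in> P \<and> i \<noteq> Min P")
        case False
        then show ?thesis using i by (force simp: path_matching_def)
      next
        case True
        let ?A = "{l \<in> P. l < i}"
        have "Min P \<in> P" "Min P \<le> i" using True finP by (auto intro: Min_in Min_le)
        then have ne: "?A \<noteq> {}" using True by force
        have "Max ?A \<in> ?A" using ne finP by (intro Max_in) auto
        moreover have "\<not> (Max ?A < l \<and> l < i)" if "l \<in> P" for l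
        proof
          assume l: "Max ?A < l \<and> l < i"
          then have "l \<le> Max ?A" using that finP by (intro Max_ge) auto
          then show False using l by simp
        qed
        ultimately have "(i, Max ?A) \<in> path_matching n P"
          using True unfolding path_matching_def by blast
        then show ?thesis by force
      qed
    qed
    moreover have "finite (path_matching n P)"
      using m finite_states(2)[OF bigraph_staircase, of n] by (auto simp: matchings_def intro: finite_subset)
    ultimately have "n \<le> card (fst ` path_matching n P \<union> {Min P})"
      using card_mono[of "fst ` path_matching n P \<union> {Min P}" "{..<n}"] by simp
    also have "\<dots> \<le> card (fst ` path_matching n P) + 1"
      using card_Un_le[of "fst ` path_matching n P" "{Min P}"] by simp
    finally show ?thesis using card_matching(1)[OF m] by simp
  qed
  then show ?thesis using m by (simp add: states_iff[OF bigraph_staircase])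
qed

lemma deviation_path_matching:
  assumes "P \<subseteq> {..<n}" shows "deviation n (path_matching n P) = P"
  using assms by (auto simp: deviation_def path_matching_def)

lemma bij_betw_deviation: "bij_betw (deviation n) (states (staircase n)) (Pow {..<n})"
  unfolding bij_betw_def
proof (intro conjI inj_on_deviation equalityI subsetI)
  fix P assume "P \<in> Pow {..<n}"
  then show "P \<in> deviation n ` states (staircase n)"
    using deviation_path_matching path_matching_in_states by (metis PowD imageI)
qed (auto simp: deviation_def)

lemma card_states_deviation:
  "card {M \<in> states (staircase n). Q (deviation n M)} = card {P \<in> Pow {..<n}. Q P}"
proof (rule bij_betw_same_card)
  show "bij_betw (deviation n) {M \<in> states (staircase n). Q (deviation n M)} {P \<in> Pow {..<n}. Q P}"
  proof (rule bij_betw_imageI)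
    show "inj_on (deviation n) {M \<in> states (staircase n). Q (deviation n M)}"
      by (rule inj_on_subset[OF inj_on_deviation]) auto
    show "deviation n ` {M \<in> states (staircase n). Q (deviation n M)} = {P \<in> Pow {..<n}. Q P}"
      unfolding bij_betw_imp_surj_on[OF bij_betw_deviation, symmetric] by blast
  qed
qed

lemma card_Pow_avoiding:
  assumes "c < n" shows "card {P \<in> Pow {..<n}. c \<notin> P} = 2 ^ (n - 1)"
proof -
  have "{P \<in> Pow {..<n}. c \<notin> P} = Pow ({..<n} - {c})" by auto
  then show ?thesis using assms by (simp add: card_Pow)
qed

text \<open>Outside perfect matchings, the edge at \<open>c\<close> can only be displaced by an edge
  joining a free row \<open>u > c\<close> to column \<open>c\<close>, or row \<open>c\<close> to a
  free column \<open>v < c\<close>. All rows before the free row are matched, hence on the diagonal,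
  and dually for columns. The summands count the deviations on the two sides of \<open>c\<close> and
  the empty one.\<close>

lemma staircase_frontier:
  assumes "c < n"
  defines "S \<equiv> {M \<in> states (staircase n). (c, c) \<in> M}"
  shows "card (frontier_states (staircase n) S) \<le> 2 ^ c + 2 ^ (n - Suc c) + 1"
proof -
  let ?G = "staircase n"
  note G = bigraph_staircase[of n]
  have "frontier_states ?G S \<subseteq> {M \<in> states ?G. deviation n M \<subseteq> {..<c}} \<union>
     {M \<in> states ?G. deviation n M \<subseteq> {c<..<n}} \<union> {M \<in> states ?G. deviation n M = {}}"
  proof
    fix M assume "M \<in> frontier_states ?G S"
    then obtain u v where M: "M \<in> states ?G" "(c, c) \<in> M" and e: "v \<le> u" "u < n"
        and out: "broder_move ?G M (u, v) \<notin> S"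
      by (auto simp: frontier_states_def S_def)
    have m: "M \<in> matchings ?G" using M by (simp add: states_iff[OF G])
    have "broder_move ?G M (u, v) \<in> states ?G" using move_cases[OF G M(1), of "(u, v)"] e by auto
    then have rem: "(c, c) \<notin> broder_move ?G M (u, v)" using out by (auto simp: S_def)
    show "M \<in> {M \<in> states ?G. deviation n M \<subseteq> {..<c}} \<union>
     {M \<in> states ?G. deviation n M \<subseteq> {c<..<n}} \<union> {M \<in> states ?G. deviation n M = {}}"
    proof (cases "M \<in> perfect_matchings ?G")
      case True
      then have "{..<n} \<subseteq> fst ` M" by (simp add: perfect_matchings_def)
      then have "(i, i) \<in> M" if "i < n" for i
        using staircase_matching_low[OF m, of n i] that by blast
      then have "deviation n M = {}" by (simp add: deviation_def)
      then show ?thesis using M by simp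
    next
      case False
      then have "u \<notin> fst ` M \<and> v = c \<or> v \<notin> snd ` M \<and> u = c"
        using rem M(2) by (auto simp: broder_move_def split: if_splits)
      then show ?thesis
      proof
        assume u: "u \<notin> fst ` M \<and> v = c"
        then have uc: "c < u" using e M(2) by (metis fst_conv image_eqI le_neq_implies_less)
        have "l \<in> fst ` M" if "l < u" for l
          using unmatched_unique(1)[OF G M(1), of l u] u that e by auto
        then have "{..<u} \<subseteq> fst ` M" by blast
        then have "(i, i) \<in> M" if "i \<le> c" for i
          using staircase_matching_low[OF m, of u i] uc that by simp
        then have "deviation n M \<subseteq> {c<..<n}" by (force simp: deviation_def not_less[symmetric])
        then show ?thesis using M by simp
      next
        assume v: "v \<notin> snd ` M \<and> u = c"
        then have vc: "v < c" using e M(2) by (metis snd_conv image_eqI le_neq_implies_less)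
        have "l \<in> snd ` M" if "v < l" "l < n" for l
          using unmatched_unique(2)[OF G M(1), of l v] v that e by auto
        then have "{v<..<n} \<subseteq> snd ` M" by auto
        then have "(i, i) \<in> M" if "c \<le> i" "i < n" for i
          using staircase_matching_high[OF m, of v i] vc that by simp
        then have "deviation n M \<subseteq> {..<c}" by (force simp: deviation_def not_less[symmetric])
        then show ?thesis using M by simp
      qed
    qed
  qed
  then have "card (frontier_states ?G S) \<le> card ({M \<in> states ?G. deviation n M \<subseteq> {..<c}} \<union>
     {M \<in> states ?G. deviation n M \<subseteq> {c<..<n}} \<union> {M \<in> states ?G. deviation n M = {}})"
    using finite_states(1)[OF G] by (intro card_mono) auto
  also have "\<dots> \<le> card {M \<in> states ?G. deviation n M \<subseteq> {..<c}} +
     card {M \<in> states ?G. deviation n M \<subseteq> {c<..<n}} + card {M \<in> states ?G. deviation n M = {}}"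
    by (intro order_trans[OF card_Un_le] add_mono card_Un_le order_refl)
  also have "card {M \<in> states ?G. deviation n M \<subseteq> {..<c}} = card (Pow {..<c})"
  proof -
    have "{P \<in> Pow {..<n}. P \<subseteq> {..<c}} = Pow {..<c}" using assms(1) by auto
    then show ?thesis using card_states_deviation[of n "\<lambda>P. P \<subseteq> {..<c}"] by simp
  qed
  also have "card {M \<in> states ?G. deviation n M \<subseteq> {c<..<n}} = card (Pow {c<..<n})"
  proof -
    have "{P \<in> Pow {..<n}. P \<subseteq> {c<..<n}} = Pow {c<..<n}" by auto
    then show ?thesis using card_states_deviation[of n "\<lambda>P. P \<subseteq> {c<..<n}"] by simp
  qed
  also have "card {M \<in> states ?G. deviation n M = {}} = 1"
  proof -
    have "{P \<in> Pow {..<n}. P = {}} = {{}}" by auto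
    then show ?thesis using card_states_deviation[of n "\<lambda>P. P = {}"] by simp
  qed
  finally show ?thesis by (simp add: card_Pow)
qed

text \<open>With \<open>n = 2 * k + 1\<close> the index \<open>k\<close> has \<open>k\<close>
  indices on each side: the frontier has at most \<open>2 * 2 ^ k + 1\<close> states, while
  \<open>S\<close> has \<open>2 ^ (2 * k)\<close>, half of all states.\<close>

lemma not_rapidly_mixing_threshold:
  "\<not> rapidly_mixing_on {G :: (nat, nat) bigraph. bigraph G \<and> threshold G}"
proof (rule not_rapidly_mixingI[where G = "\<lambda>k. staircase (2 * k + 1)" and c = 2 and C = 3])
  fix k :: nat
  let ?n = "2 * k + 1"
  let ?G = "staircase ?n"
  note G = bigraph_staircase[of ?n]
  show "?G \<in> {G. bigraph G \<and> threshold G}" by (simp add: bigraph_staircase threshold_staircase)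
  show "bigraph ?G" "lverts ?G \<noteq> {}" by (auto simp: bigraph_staircase)
  have "(\<lambda>i. (i, i)) ` {..<?n} \<in> perfect_matchings ?G"
    by (auto simp: perfect_matchings_def matchings_def image_image)
  then show "perfect_matchings ?G \<noteq> {}" by blast
  show "card (lverts ?G) \<le> 2 * (k + 1)" by simp
  define S where "S = {M \<in> states ?G. (k, k) \<in> M}"
  have "S = {M \<in> states ?G. k \<notin> deviation ?n M}" by (auto simp: S_def deviation_def)
  then have cS: "card S = 2 ^ (2 * k)"
    using card_states_deviation[of ?n "\<lambda>P. k \<notin> P"] card_Pow_avoiding[of k ?n] by simp
  have cs: "card (states ?G) = 2 ^ ?n"
    using bij_betw_same_card[OF bij_betw_deviation[of ?n]] by (simp add: card_Pow)
  have "card (frontier_states ?G S) \<le> 2 ^ k + 2 ^ (?n - Suc k) + 1"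
    unfolding S_def by (rule staircase_frontier) simp
  also have "\<dots> \<le> 3 * 2 ^ k" by simp
  finally have "card (frontier_states ?G S) * 2 ^ k \<le> 3 * 2 ^ k * 2 ^ k" by simp
  also have "\<dots> = 3 * card S" by (simp add: cS mult_2 power_add)
  also have "\<dots> \<le> 3 * (k + 1) ^ 2 * card S" by simp
  finally have "card (frontier_states ?G S) * 2 ^ k \<le> 3 * (k + 1) ^ 2 * card S" .
  moreover have "S \<noteq> {}" using cS by (metis card.empty power_not_zero zero_neq_numeral)
  ultimately show "\<exists>S. S \<subseteq> states ?G \<and> S \<noteq> {} \<and> 2 * card S \<le> card (states ?G) \<and>
       card (frontier_states ?G S) * 2 ^ k \<le> 3 * (k + 1) ^ 2 * card S"
    using cS cs by (intro exI[of _ S]) (auto simp: S_def)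
qed

section \<open>Hubs joined by chains of cells\<close>

text \<open>
  \<open>theta r k s C\<close> consists of two vertices, both called \<open>hub r\<close> (one on each side), joined by \<open>r\<close>
  chains of \<open>k\<close> cells. The nodes \<open>node c i a\<close> with \<open>a < s\<close> of both sides form the \<open>i\<close>-th cell of chain
  \<open>c\<close>, with edge set \<open>C\<close>; those with \<open>a = 0\<close> are its ports. The link \<open>j\<close> of a chain enters cell \<open>j\<close>
  at its right port and leaves cell \<open>j - 1\<close> at its left port, a missing cell being replaced by a hub.
\<close>

definition node :: "nat \<Rightarrow> nat \<Rightarrow> nat \<Rightarrow> nat" where
  "node c i a = prod_encode (c, prod_encode (i, a))"

lemma node_eq_iff [simp]: "node c i a = node c' i' a' \<longleftrightarrow> c = c' \<and> i = i' \<and> a = a'"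
  by (simp add: node_def prod_encode_eq)

definition cell_nodes :: "nat \<Rightarrow> nat \<Rightarrow> nat \<Rightarrow> nat set" where
  "cell_nodes r k s = {node c i a | c i a. c < r \<and> i < k \<and> a < s}"

text \<open>The chains are numbered below \<open>r\<close>, so this code differs from all nodes of
  cells.\<close>

definition hub :: "nat \<Rightarrow> nat" where
  "hub r = node r 0 0"

definition link_left :: "nat \<Rightarrow> nat \<Rightarrow> nat \<Rightarrow> nat" where
  "link_left r c j = (if j = 0 then hub r else node c (j - 1) 0)"

definition link_right :: "nat \<Rightarrow> nat \<Rightarrow> nat \<Rightarrow> nat \<Rightarrow> nat" where
  "link_right r k c j = (if j = k then hub r else node c j 0)"

definition link :: "nat \<Rightarrow> nat \<Rightarrow> nat \<Rightarrow> nat \<Rightarrow> nat \<times> nat" where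
  "link r k c j = (link_left r c j, link_right r k c j)"

definition theta :: "nat \<Rightarrow> nat \<Rightarrow> nat \<Rightarrow> (nat \<times> nat) set \<Rightarrow> (nat, nat) bigraph" where
  "theta r k s C = \<lparr>lverts = insert (hub r) (cell_nodes r k s), rverts = insert (hub r) (cell_nodes r k s),
     edges = {(node c i a, node c i b) | c i a b. c < r \<and> i < k \<and> (a, b) \<in> C} \<union>
       {link r k c j | c j. c < r \<and> j \<le> k}\<rparr>"

text \<open>For \<open>a = 0\<close> these are the perfect matchings of the cell, for \<open>a = 1\<close> those of the cell without ports.\<close>

definition cell_matchings :: "nat \<Rightarrow> (nat \<times> nat) set \<Rightarrow> nat \<Rightarrow> (nat \<times> nat) set set" where
  "cell_matchings s C a = {m. m \<subseteq> C \<and> fst ` m = {a..<s} \<and> snd ` m = {a..<s} \<and>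
     (\<forall>e\<in>m. \<forall>e'\<in>m. e \<noteq> e' \<longrightarrow> fst e \<noteq> fst e' \<and> snd e \<noteq> snd e')}"

definition cell_part :: "(nat \<times> nat) set \<Rightarrow> nat \<Rightarrow> nat \<Rightarrow> (nat \<times> nat) set" where
  "cell_part M c i = {(a, b). (node c i a, node c i b) \<in> M}"

lemma theta_simps [simp]:
  "lverts (theta r k s C) = insert (hub r) (cell_nodes r k s)"
  "rverts (theta r k s C) = insert (hub r) (cell_nodes r k s)"
  by (simp_all add: theta_def)

lemma hub_notin_cell_nodes [simp]: "hub r \<notin> cell_nodes r k s"
  by (auto simp: hub_def cell_nodes_def)

lemma cell_nodes_eq: "cell_nodes r k s = (\<lambda>(c, i, a). node c i a) ` ({..<r} \<times> {..<k} \<times> {..<s})"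
  by (force simp: cell_nodes_def)

lemma finite_cell_nodes [simp]: "finite (cell_nodes r k s)"
  by (simp add: cell_nodes_eq)

lemma card_cell_nodes: "card (cell_nodes r k s) = r * k * s"
proof -
  have "inj_on (\<lambda>(c, i, a). node c i a) ({..<r} \<times> {..<k} \<times> {..<s})"
    by (auto simp: inj_on_def)
  then show ?thesis by (simp add: cell_nodes_eq card_image card_cartesian_product)
qed

lemma node_in_cell_nodes [simp]: "node c i a \<in> cell_nodes r k s \<longleftrightarrow> c < r \<and> i < k \<and> a < s"
  by (auto simp: cell_nodes_def)

text \<open>\<open>few\<close> is the factor 2 that a crossed cell costs; with \<open>ne\<close> it
  gives at least two perfect matchings of a cell. \<open>ne\<close> also makes it possible to cross
  a whole chain, which a perfect matching has to do.\<close>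

locale theta_graph =
  fixes r k s :: nat and C :: "(nat \<times> nat) set"
  assumes r_pos: "0 < r" and k_pos: "0 < k" and s_pos: "0 < s"
    and C_sub: "C \<subseteq> {..<s} \<times> {..<s}"
    and few: "2 * card (cell_matchings s C 1) \<le> card (cell_matchings s C 0)"
    and ne: "cell_matchings s C 1 \<noteq> {}"
begin

abbreviation G where "G \<equiv> theta r k s C"
abbreviation lk where "lk \<equiv> link r k"
abbreviation cells where "cells \<equiv> {..<r} \<times> {..<k}"

lemma edges_G: "edges G = {(node c i a, node c i b) | c i a b. c < r \<and> i < k \<and> (a, b) \<in> C} \<union>
       {lk c j | c j. c < r \<and> j \<le> k}"
  by (simp add: theta_def)

lemma link_left_in: "c < r \<Longrightarrow> j \<le> k \<Longrightarrow> link_left r c j \<in> lverts G"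
  using s_pos by (auto simp: link_left_def)

lemma link_right_in: "c < r \<Longrightarrow> j \<le> k \<Longrightarrow> link_right r k c j \<in> rverts G"
  using s_pos by (auto simp: link_right_def)

lemma bigraph_G: "bigraph G"
proof -
  have "edges G \<subseteq> lverts G \<times> rverts G"
  proof
    fix e assume "e \<in> edges G"
    then consider c i a b where "e = (node c i a, node c i b)" "c < r" "i < k" "(a, b) \<in> C"
      | c j where "e = lk c j" "c < r" "j \<le> k" by (auto simp: edges_G)
    then show "e \<in> lverts G \<times> rverts G"
    proof cases
      case 1
      then show ?thesis using C_sub by auto
    next
      case 2
      then show ?thesis unfolding link_def using link_left_in link_right_in by blast
    qed
  qed
  then show ?thesis by (simp add: bigraph_def)
qed

lemma card_lverts: "card (lverts G) = r * k * s + 1"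
  by (simp add: card_cell_nodes)

lemma finite_C: "finite C"
  using C_sub finite_subset by blast

lemma finite_cell_matchings: "finite (cell_matchings s C a)"
  by (rule finite_subset[of _ "Pow C"]) (auto simp: cell_matchings_def finite_C)

text \<open>On the left side only the port has an edge out of its cell, namely the next link;
  \<open>c < r\<close> excludes the hub, which is also a \<open>node\<close>.\<close>

lemma edge_from_node:
  assumes "(node c i a, v) \<in> edges G" "c < r"
  shows "(\<exists>b. v = node c i b \<and> (a, b) \<in> C) \<or> (a = 0 \<and> (node c i a, v) = lk c (Suc i))"
  using assms by (auto simp: edges_G link_def link_left_def hub_def split: if_splits)

lemma edge_to_node:
  assumes "(u, node c i b) \<in> edges G" "c < r"
  shows "(\<exists>a. u = node c i a \<and> (a, b) \<in> C) \<or> (b = 0 \<and> (u, node c i b) = lk c i)"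
  using assms by (auto simp: edges_G link_def link_right_def hub_def split: if_splits)

lemma edge_from_hub: "(hub r, v) \<in> edges G \<Longrightarrow> \<exists>c<r. (hub r, v) = lk c 0"
  using k_pos by (auto simp: edges_G link_def link_left_def hub_def split: if_splits)

lemma edge_to_hub: "(u, hub r) \<in> edges G \<Longrightarrow> \<exists>c<r. (u, hub r) = lk c k"
  by (auto simp: edges_G link_def link_right_def hub_def split: if_splits)

lemma cell_edgeD: "(node c i a, node c i b) \<in> edges G \<Longrightarrow> c < r \<Longrightarrow> (a, b) \<in> C"
  by (auto simp: edges_G link_def link_left_def link_right_def hub_def split: if_splits)

section \<open>Holes, used links and their balance along a chain\<close>

definition lhole :: "(nat \<times> nat) set \<Rightarrow> nat \<Rightarrow> nat \<Rightarrow> nat set" where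
  "lhole M c i = {a. a < s \<and> node c i a \<notin> fst ` M}"

definition rhole :: "(nat \<times> nat) set \<Rightarrow> nat \<Rightarrow> nat \<Rightarrow> nat set" where
  "rhole M c i = {b. b < s \<and> node c i b \<notin> snd ` M}"

text \<open>A number rather than a truth value: it enters the balance of a cell and selects the set
  \<open>cell_matchings s C (used M c i)\<close>.\<close>

definition used :: "(nat \<times> nat) set \<Rightarrow> nat \<Rightarrow> nat \<Rightarrow> nat" where
  "used M c j = (if lk c j \<in> M then 1 else 0)"

definition intact :: "(nat \<times> nat) set \<Rightarrow> nat \<Rightarrow> nat \<Rightarrow> bool" where
  "intact M c i \<longleftrightarrow> lhole M c i = {} \<and> rhole M c i = {}"

lemma lk_Suc: "lk c (Suc i) = (node c i 0, link_right r k c (Suc i))"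
  by (simp add: link_def link_left_def)

lemma lk_less: "i < k \<Longrightarrow> lk c i = (link_left r c i, node c i 0)"
  by (simp add: link_def link_right_def)

lemma link_right_Suc_neq: "c < r \<Longrightarrow> link_right r k c (Suc i) \<noteq> node c i b"
  by (auto simp: link_right_def hub_def)

lemma link_left_neq: "c < r \<Longrightarrow> link_left r c i \<noteq> node c i b"
  by (auto simp: link_left_def hub_def)

lemma fst_cell_part:
  assumes M: "M \<in> matchings G" and "c < r" "i < k"
  shows "fst ` cell_part M c i = {..<s} - lhole M c i - (if lk c (Suc i) \<in> M then {0} else {})"
proof (intro equalityI subsetI)
  have ME: "M \<subseteq> edges G" using M by (simp add: matchings_def)
  fix a assume "a \<in> fst ` cell_part M c i"
  then obtain b where ab: "(node c i a, node c i b) \<in> M" by (auto simp: cell_part_def)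
  then have "(a, b) \<in> C" using ME cell_edgeD assms by blast
  then have "a < s" using C_sub by auto
  moreover have "node c i a \<in> fst ` M" using ab by force
  moreover have "a \<noteq> 0" if "lk c (Suc i) \<in> M"
    using matching_unique(1)[OF M ab] that link_right_Suc_neq[OF assms(2)] by (metis lk_Suc)
  ultimately show "a \<in> {..<s} - lhole M c i - (if lk c (Suc i) \<in> M then {0} else {})"
    by (auto simp: lhole_def)
next
  have ME: "M \<subseteq> edges G" using M by (simp add: matchings_def)
  fix a assume a: "a \<in> {..<s} - lhole M c i - (if lk c (Suc i) \<in> M then {0} else {})"
  then obtain v where v: "(node c i a, v) \<in> M" by (auto simp: lhole_def)
  then have "(node c i a, v) \<in> edges G" using ME by blast
  moreover have "a \<noteq> 0 \<or> (node c i a, v) \<noteq> lk c (Suc i)"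
    using a v by (cases "a = 0") (auto split: if_splits)
  ultimately have "\<exists>b. v = node c i b"
    using edge_from_node[OF _ assms(2)] by blast
  then show "a \<in> fst ` cell_part M c i" using v by (force simp: cell_part_def)
qed

lemma snd_cell_part:
  assumes M: "M \<in> matchings G" and "c < r" "i < k"
  shows "snd ` cell_part M c i = {..<s} - rhole M c i - (if lk c i \<in> M then {0} else {})"
proof (intro equalityI subsetI)
  have ME: "M \<subseteq> edges G" using M by (simp add: matchings_def)
  fix b assume "b \<in> snd ` cell_part M c i"
  then obtain a where ab: "(node c i a, node c i b) \<in> M" by (auto simp: cell_part_def)
  then have "(a, b) \<in> C" using ME cell_edgeD assms by blast
  then have "b < s" using C_sub by auto
  moreover have "node c i b \<in> snd ` M" using ab by force
  moreover have "b \<noteq> 0" if "lk c i \<in> M"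
    using matching_unique(2)[OF M ab] that link_left_neq[OF assms(2)] by (metis lk_less[OF assms(3)])
  ultimately show "b \<in> {..<s} - rhole M c i - (if lk c i \<in> M then {0} else {})"
    by (auto simp: rhole_def)
next
  have ME: "M \<subseteq> edges G" using M by (simp add: matchings_def)
  fix b assume b: "b \<in> {..<s} - rhole M c i - (if lk c i \<in> M then {0} else {})"
  then obtain u where u: "(u, node c i b) \<in> M" by (auto simp: rhole_def)
  then have "(u, node c i b) \<in> edges G" using ME by blast
  moreover have "b \<noteq> 0 \<or> (u, node c i b) \<noteq> lk c i"
    using b u by (cases "b = 0") (auto split: if_splits)
  ultimately have "\<exists>a. u = node c i a"
    using edge_to_node[OF _ assms(2)] by blast
  then show "b \<in> snd ` cell_part M c i" using u by (force simp: cell_part_def)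
qed

lemma cell_part_sub: "M \<in> matchings G \<Longrightarrow> c < r \<Longrightarrow> cell_part M c i \<subseteq> C"
  using cell_edgeD by (auto simp: cell_part_def matchings_def)

lemma cell_part_matching:
  assumes "M \<in> matchings G" "e \<in> cell_part M c i" "e' \<in> cell_part M c i" "e \<noteq> e'"
  shows "fst e \<noteq> fst e' \<and> snd e \<noteq> snd e'"
  using assms matchingD[OF assms(1)] by (fastforce simp: cell_part_def)

text \<open>
  Counting the matched vertices on both sides of a cell shows that, along a chain, whether a link is
  used changes only at holes.
\<close>

lemma balance:
  assumes M: "M \<in> matchings G" and c: "c < r" "i < k"
  shows "card (lhole M c i) + used M c (Suc i) = card (rhole M c i) + used M c i"
proof -
  let ?m = "cell_part M c i"
  have "card (fst ` ?m) = card ?m" "card (snd ` ?m) = card ?m"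
    by (auto intro!: card_image inj_onI dest: cell_part_matching[OF M])
  then have eq: "card (fst ` ?m) = card (snd ` ?m)" by simp
  have sub: "lhole M c i \<subseteq> {..<s}" "rhole M c i \<subseteq> {..<s}" by (auto simp: lhole_def rhole_def)
  have fin: "finite (lhole M c i)" "finite (rhole M c i)" using sub finite_subset by blast+
  \<comment> \<open>A port that uses its link is matched, hence not a hole, so the two deductions
    from \<open>s\<close> are disjoint.\<close>
  have z1: "0 \<notin> lhole M c i" if "lk c (Suc i) \<in> M"
    using that by (force simp: lhole_def lk_Suc)
  have z2: "0 \<notin> rhole M c i" if "lk c i \<in> M"
    using that by (force simp: rhole_def lk_less[OF c(2)])
  have Diff_Un_eq: "A - B - D = A - (B \<union> D)" for A B D :: "nat set" by blast
  have "card (fst ` ?m) + card (lhole M c i) + used M c (Suc i) = s"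
  proof -
    have "card ({..<s} - (lhole M c i \<union> (if lk c (Suc i) \<in> M then {0} else {}))) =
        s - card (lhole M c i \<union> (if lk c (Suc i) \<in> M then {0} else {}))"
      using sub fin s_pos by (subst card_Diff_subset) auto
    moreover have "card (lhole M c i \<union> (if lk c (Suc i) \<in> M then {0} else {})) = card (lhole M c i) + used M c (Suc i)"
      using z1 fin by (simp add: used_def)
    moreover have "card (lhole M c i \<union> (if lk c (Suc i) \<in> M then {0} else {})) \<le> card {..<s}"
      using sub s_pos by (intro card_mono) auto
    ultimately show ?thesis unfolding fst_cell_part[OF M c] Diff_Un_eq by simp
  qed
  moreover have "card (snd ` ?m) + card (rhole M c i) + used M c i = s"
  proof -
    have "card ({..<s} - (rhole M c i \<union> (if lk c i \<in> M then {0} else {}))) =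
        s - card (rhole M c i \<union> (if lk c i \<in> M then {0} else {}))"
      using sub fin s_pos by (subst card_Diff_subset) auto
    moreover have "card (rhole M c i \<union> (if lk c i \<in> M then {0} else {})) = card (rhole M c i) + used M c i"
      using z2 fin by (simp add: used_def)
    moreover have "card (rhole M c i \<union> (if lk c i \<in> M then {0} else {})) \<le> card {..<s}"
      using sub s_pos by (intro card_mono) auto
    ultimately show ?thesis unfolding snd_cell_part[OF M c] Diff_Un_eq by simp
  qed
  ultimately show ?thesis using eq by linarith
qed

lemma balance_sum:
  assumes M: "M \<in> matchings G" and c: "c < r" and "i \<le> j" "j \<le> k"
  shows "(\<Sum>l\<in>{i..<j}. card (lhole M c l)) + used M c j = (\<Sum>l\<in>{i..<j}. card (rhole M c l)) + used M c i"
  using assms(3,4)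
proof (induction j rule: dec_induct)
  case (step j)
  then show ?case using balance[OF M c, of j] by simp
qed simp

lemma used_intact:
  assumes "M \<in> matchings G" "c < r" "i \<le> j" "j \<le> k" "\<And>l. i \<le> l \<Longrightarrow> l < j \<Longrightarrow> intact M c l"
  shows "used M c j = used M c i"
  using balance_sum[OF assms(1-4)] assms(5) by (simp add: intact_def)

lemma cell_part_intact:
  assumes M: "M \<in> matchings G" and c: "c < r" "i < k" and "intact M c i"
  shows "cell_part M c i \<in> cell_matchings s C (used M c i)"
proof -
  have "used M c (Suc i) = used M c i"
    using used_intact[OF M c(1), of i "Suc i"] assms by (auto simp: le_less_Suc_eq)
  then have "fst ` cell_part M c i = {used M c i..<s}" "snd ` cell_part M c i = {used M c i..<s}"
    using fst_cell_part[OF M c] snd_cell_part[OF M c] assms(4)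
    by (auto simp: intact_def used_def split: if_splits)
  then show ?thesis
    using cell_part_sub[OF M c(1)] cell_part_matching[OF M] by (auto simp: cell_matchings_def)
qed

section \<open>States assembled from cell matchings\<close>

text \<open>\<open>f\<close> prescribes the matching of each cell and \<open>L\<close> the chains
  crossed from hub to hub. The empty \<open>L\<close> leaves exactly the hubs free and serves to
  produce many states; \<open>{0}\<close> yields a perfect matching.\<close>

definition glue :: "(nat \<times> nat \<Rightarrow> (nat \<times> nat) set) \<Rightarrow> nat set \<Rightarrow> (nat \<times> nat) set" where
  "glue f L = {(node c i a, node c i b) | c i a b. c < r \<and> i < k \<and> (a, b) \<in> f (c, i)} \<union>
     {lk c j | c j. c \<in> L \<and> j \<le> k}"

lemma cell_part_glue: "c < r \<Longrightarrow> i < k \<Longrightarrow> L \<subseteq> {..<r} \<Longrightarrow> cell_part (glue f L) c i = f (c, i)"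
  by (auto simp: cell_part_def glue_def link_def link_left_def link_right_def hub_def split: if_splits)

lemma glue_from_node:
  assumes "(node c i a, v) \<in> glue f L" "c < r"
  shows "(i < k \<and> (\<exists>b. v = node c i b \<and> (a, b) \<in> f (c, i))) \<or> (a = 0 \<and> c \<in> L \<and> v = link_right r k c (Suc i))"
  using assms by (auto simp: glue_def link_def link_left_def hub_def split: if_splits)

lemma glue_to_node:
  assumes "(u, node c i b) \<in> glue f L" "c < r"
  shows "(i < k \<and> (\<exists>a. u = node c i a \<and> (a, b) \<in> f (c, i))) \<or> (b = 0 \<and> c \<in> L \<and> u = link_left r c i)"
  using assms by (auto simp: glue_def link_def link_right_def hub_def split: if_splits)

lemma glue_from_hub: "(hub r, v) \<in> glue f L \<Longrightarrow> \<exists>c\<in>L. v = link_right r k c 0"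
  if "L \<subseteq> {..<r}"
  using that by (auto simp: glue_def link_def link_left_def hub_def split: if_splits)

lemma glue_to_hub: "(u, hub r) \<in> glue f L \<Longrightarrow> \<exists>c\<in>L. u = link_left r c k"
  if "L \<subseteq> {..<r}"
  using that by (auto simp: glue_def link_def link_right_def hub_def split: if_splits)

text \<open>Each hub has only one partner, so at most one chain can be crossed.\<close>

lemma glue_matching:
  assumes f: "\<And>c i. c < r \<Longrightarrow> i < k \<Longrightarrow> f (c, i) \<in> cell_matchings s C (if c \<in> L then 1 else 0)"
    and L: "L \<subseteq> {..<r}" "\<And>c c'. c \<in> L \<Longrightarrow> c' \<in> L \<Longrightarrow> c = c'"
  shows "glue f L \<in> matchings G"
proof (rule matchingI)
  have fC: "(a, b) \<in> C" if "c < r" "i < k" "(a, b) \<in> f (c, i)" for a b c i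
    using f[OF that(1,2)] that(3) by (auto simp: cell_matchings_def)
  show E: "(u, v) \<in> edges G" if "(u, v) \<in> glue f L" for u v
  proof -
    consider c i a b where "(u, v) = (node c i a, node c i b)" "c < r" "i < k" "(a, b) \<in> f (c, i)"
      | c j where "(u, v) = lk c j" "c \<in> L" "j \<le> k"
      using \<open>(u, v) \<in> glue f L\<close> unfolding glue_def by blast
    then show ?thesis
    proof cases
      case 1
      then show ?thesis using fC unfolding edges_G by blast
    next
      case 2
      then show ?thesis using L(1) unfolding edges_G by blast
    qed
  qed
  \<comment> \<open>In a crossed chain the cell matchings avoid index 0, which leaves both ports to
    the links.\<close>
  have z: "a \<noteq> 0" "b \<noteq> 0" if "c < r" "i < k" "c \<in> L" "(a, b) \<in> f (c, i)" for a b c i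
  proof -
    have "a \<in> fst ` f (c, i)" "b \<in> snd ` f (c, i)" using that by force+
    then show "a \<noteq> 0" "b \<noteq> 0" using f[OF that(1,2)] that(3) by (auto simp: cell_matchings_def)
  qed
  have un: "a = a' \<longleftrightarrow> b = b'" if "c < r" "i < k" "(a, b) \<in> f (c, i)" "(a', b') \<in> f (c, i)" for a b a' b' c i
  proof -
    have "\<forall>e\<in>f (c, i). \<forall>e'\<in>f (c, i). e \<noteq> e' \<longrightarrow> fst e \<noteq> fst e' \<and> snd e \<noteq> snd e'"
      using f[OF that(1,2)] by (simp add: cell_matchings_def)
    from bspec[OF bspec[OF this that(3)] that(4)] show ?thesis by auto
  qed
  have ends: "w = hub r \<or> (\<exists>c i a. w = node c i a \<and> c < r)" if "w \<in> insert (hub r) (cell_nodes r k s)" for w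
    using that by (auto simp: cell_nodes_def)
  show "v = v'" if uv: "(u, v) \<in> glue f L" "(u', v') \<in> glue f L" and "u = u'" for u v u' v'
  proof -
    have uv': "(u, v') \<in> glue f L" using that by simp
    have "u \<in> lverts G" using E[OF uv(1)] bigraph_G by (auto simp: bigraph_def)
    then consider "u = hub r" | c i a where "u = node c i a" "c < r" using ends[of u] by auto
    then show ?thesis
    proof cases
      case 1
      then show ?thesis using glue_from_hub[OF L(1)] uv(1) uv' L(2) by metis
    next
      case 2
      then show ?thesis
        using glue_from_node[OF uv(1)[unfolded 2(1)] 2(2)] glue_from_node[OF uv'[unfolded 2(1)] 2(2)]
          un[OF 2(2)] z[OF 2(2)] by metis
    qed
  qed
  show "u = u'" if uv: "(u, v) \<in> glue f L" "(u', v') \<in> glue f L" and "v = v'" for u v u' v'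
  proof -
    have uv': "(u', v) \<in> glue f L" using that by simp
    have "v \<in> rverts G" using E[OF uv(1)] bigraph_G by (auto simp: bigraph_def)
    then consider "v = hub r" | c i b where "v = node c i b" "c < r" using ends[of v] by auto
    then show ?thesis
    proof cases
      case 1
      then show ?thesis using glue_to_hub[OF L(1)] uv(1) uv' L(2) by metis
    next
      case 2
      then show ?thesis
        using glue_to_node[OF uv(1)[unfolded 2(1)] 2(2)] glue_to_node[OF uv'[unfolded 2(1)] 2(2)]
          un[OF 2(2)] z[OF 2(2)] by metis
    qed
  qed
qed

lemma glue_covers:
  assumes f: "\<And>c i. c < r \<Longrightarrow> i < k \<Longrightarrow> f (c, i) \<in> cell_matchings s C (if c \<in> L then 1 else 0)"
    and L: "L \<subseteq> {..<r}"
  shows "cell_nodes r k s \<subseteq> fst ` glue f L" "cell_nodes r k s \<subseteq> snd ` glue f L"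
    "L \<noteq> {} \<Longrightarrow> hub r \<in> fst ` glue f L" "L \<noteq> {} \<Longrightarrow> hub r \<in> snd ` glue f L"
proof -
  have l: "lk c j \<in> glue f L" if "c \<in> L" "j \<le> k" for c j using that by (auto simp: glue_def)
  show "cell_nodes r k s \<subseteq> fst ` glue f L"
  proof
    fix x assume "x \<in> cell_nodes r k s"
    then obtain c i a where x: "x = node c i a" "c < r" "i < k" "a < s" by (auto simp: cell_nodes_def)
    show "x \<in> fst ` glue f L"
    proof (cases "c \<in> L \<and> a = 0")
      case True
      then show ?thesis using l[of c "Suc i"] x by (force simp: lk_Suc)
    next
      case False
      then have "a \<in> fst ` f (c, i)" using f[OF x(2,3)] x(4) by (auto simp: cell_matchings_def split: if_splits)
      then show ?thesis using x by (force simp: glue_def)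
    qed
  qed
  show "cell_nodes r k s \<subseteq> snd ` glue f L"
  proof
    fix x assume "x \<in> cell_nodes r k s"
    then obtain c i a where x: "x = node c i a" "c < r" "i < k" "a < s" by (auto simp: cell_nodes_def)
    show "x \<in> snd ` glue f L"
    proof (cases "c \<in> L \<and> a = 0")
      case True
      then show ?thesis using l[of c i] x by (force simp: lk_less)
    next
      case False
      then have "a \<in> snd ` f (c, i)" using f[OF x(2,3)] x(4) by (auto simp: cell_matchings_def split: if_splits)
      then show ?thesis using x by (force simp: glue_def)
    qed
  qed
  show "hub r \<in> fst ` glue f L" if "L \<noteq> {}"
    using that l[of _ 0] by (force simp: link_def link_left_def)
  show "hub r \<in> snd ` glue f L" if "L \<noteq> {}"
    using that l[of _ k] by (force simp: link_def link_right_def)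
qed

lemma perfect_matchings_G: "perfect_matchings G \<noteq> {}"
proof -
  have "cell_matchings s C 0 \<noteq> {}" using few ne finite_cell_matchings[of 1] by auto
  then obtain m0 m1 where m: "m0 \<in> cell_matchings s C 0" "m1 \<in> cell_matchings s C 1" using ne by blast
  let ?f = "\<lambda>(c, i). if c \<in> {0::nat} then m1 else m0"
  let ?M = "glue ?f {0}"
  have f: "?f (c, i) \<in> cell_matchings s C (if c \<in> {0} then 1 else 0)" for c i using m by simp
  have L: "{0} \<subseteq> {..<r}" using r_pos by simp
  have M: "?M \<in> matchings G" by (rule glue_matching[OF f L]) simp
  have "fst ` ?M \<subseteq> lverts G" "snd ` ?M \<subseteq> rverts G"
    using M bigraph_G by (auto simp: matchings_def bigraph_def)
  then have "?M \<in> perfect_matchings G"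
    using M glue_covers[OF f L] by (auto simp: perfect_matchings_def)
  then show ?thesis by blast
qed

text \<open>The hubs stay free, so no link is used and all cells other than \<open>z\<close> can be
  matched independently.\<close>

lemma card_cell_part_eq_ge:
  assumes z: "z \<in> cells" and \<mu>: "\<mu> \<in> cell_matchings s C 0"
  shows "card (cell_matchings s C 0) ^ (r * k - 1) \<le> card {M \<in> states G. cell_part M (fst z) (snd z) = \<mu>}"
proof -
  let ?F = "\<Pi>\<^sub>E x\<in>cells. if x = z then {\<mu>} else cell_matchings s C 0"
  have F: "f (c, i) \<in> cell_matchings s C (if c \<in> {} then 1 else 0)" if "f \<in> ?F" "c < r" "i < k" for f c i
    using PiE_mem[OF that(1), of "(c, i)"] that \<mu> by (auto split: if_splits)
  have "card ?F = (\<Prod>x\<in>cells. card (if x = z then {\<mu>} else cell_matchings s C 0))"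
    by (rule card_PiE) auto
  also have "\<dots> = card (cell_matchings s C 0) ^ (r * k - 1)"
    using z by (subst prod.remove[of _ z]) (auto simp: card_cartesian_product card_Diff_singleton_if
        intro!: trans[OF prod.cong[OF refl, of _ _ "\<lambda>_. card (cell_matchings s C 0)"]])
  finally have cF: "card ?F = card (cell_matchings s C 0) ^ (r * k - 1)" .
  have "card ?F \<le> card {M \<in> states G. cell_part M (fst z) (snd z) = \<mu>}"
  proof (rule card_inj_on_le)
    show "inj_on (\<lambda>f. glue f {}) ?F"
    proof (rule inj_onI)
      fix f g assume fg: "f \<in> ?F" "g \<in> ?F" "glue f {} = glue g {}"
      show "f = g"
      proof (rule PiE_ext[OF fg(1,2)])
        fix x assume "x \<in> cells"
        then show "f x = g x" using cell_part_glue[of "fst x" "snd x" "{}"] fg(3) by (metis empty_subsetI mem_Sigma_iff lessThan_iff prod.collapse)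
      qed
    qed
    show "(\<lambda>f. glue f {}) ` ?F \<subseteq> {M \<in> states G. cell_part M (fst z) (snd z) = \<mu>}"
    proof (clarify, intro conjI)
      fix f assume f: "f \<in> ?F"
      have M: "glue f {} \<in> matchings G" by (rule glue_matching[OF F[OF f]]) auto
      have "finite (glue f {})" using M finite_states(2)[OF bigraph_G] finite_subset by (auto simp: matchings_def)
      \<comment> \<open>Covering all left vertices but the hub is enough for a near-perfect
        matching.\<close>
      then have "card (cell_nodes r k s) \<le> card (fst ` glue f {})"
        using glue_covers(1)[OF F[OF f]] by (intro card_mono) auto
      then show "glue f {} \<in> states G"
        using M by (simp add: states_iff[OF bigraph_G] card_matching(1)[OF M])
      show "cell_part (glue f {}) (fst z) (snd z) = \<mu>"
        using z PiE_mem[OF f z] cell_part_glue[of "fst z" "snd z" "{}" f] by (auto simp: mem_Times_iff)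
    qed
    show "finite {M \<in> states G. cell_part M (fst z) (snd z) = \<mu>}"
      using finite_states(1)[OF bigraph_G] by simp
  qed
  then show ?thesis using cF by simp
qed

section \<open>Counting states by profile\<close>

text \<open>
  The profile determines which links are used. There are only polynomially many profiles, and states
  with the same profile differ only inside the cells.
\<close>

definition profile :: "(nat \<times> nat) set \<Rightarrow> nat set \<times> nat set \<times> nat set" where
  "profile M = (lverts G - fst ` M, rverts G - snd ` M, {c. c < r \<and> lk c 0 \<in> M})"

lemma holes_profile:
  assumes "profile M = profile M'" "c < r" "i < k"
  shows "lhole M c i = lhole M' c i" "rhole M c i = rhole M' c i"
proof -
  have "lhole M c i = {a. a < s \<and> node c i a \<in> lverts G - fst ` M}"
    "rhole M c i = {a. a < s \<and> node c i a \<in> rverts G - snd ` M}" for M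
    using assms(2,3) by (auto simp: lhole_def rhole_def)
  moreover have "lverts G - fst ` M = lverts G - fst ` M'" "rverts G - snd ` M = rverts G - snd ` M'"
    using assms(1) by (simp_all only: profile_def prod.inject)
  ultimately show "lhole M c i = lhole M' c i" "rhole M c i = rhole M' c i" by metis+
qed

text \<open>The balance summed from the start of the chain expresses each link through link 0 and
  the holes in between, all of which the profile records.\<close>

lemma used_profile:
  assumes M: "M \<in> matchings G" "M' \<in> matchings G" and eq: "profile M = profile M'"
    and c: "c < r" "j \<le> k"
  shows "used M c j = used M' c j"
proof -
  have "lk c 0 \<in> M \<longleftrightarrow> lk c 0 \<in> M'"
    using eq c(1) by (auto simp: profile_def)
  then have 0: "used M c 0 = used M' c 0" by (simp add: used_def)
  have "(\<Sum>l\<in>{0..<j}. card (lhole M c l)) = (\<Sum>l\<in>{0..<j}. card (lhole M' c l))"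
    "(\<Sum>l\<in>{0..<j}. card (rhole M c l)) = (\<Sum>l\<in>{0..<j}. card (rhole M' c l))"
    using holes_profile[OF eq c(1)] c(2) by simp_all
  then show ?thesis
    using balance_sum[OF M(1) c(1), of 0 j] balance_sum[OF M(2) c(1), of 0 j] c(2) 0 by simp
qed

lemma matching_eqI:
  assumes M: "M \<in> matchings G" "M' \<in> matchings G"
    and parts: "\<And>c i. c < r \<Longrightarrow> i < k \<Longrightarrow> cell_part M c i = cell_part M' c i"
    and u: "\<And>c j. c < r \<Longrightarrow> j \<le> k \<Longrightarrow> used M c j = used M' c j"
  shows "M = M'"
proof -
  have "e \<in> M \<longleftrightarrow> e \<in> M'" if "e \<in> edges G" for e
  proof -
    consider c i a b where "e = (node c i a, node c i b)" "c < r" "i < k"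
      | c j where "e = lk c j" "c < r" "j \<le> k"
      using \<open>e \<in> edges G\<close> by (auto simp: edges_G)
    then show ?thesis
    proof cases
      case 1
      then show ?thesis using parts[OF 1(2,3)] by (auto simp: cell_part_def set_eq_iff)
    next
      case 2
      then show ?thesis using u[OF 2(2,3)] by (auto simp: used_def split: if_splits)
    qed
  qed
  then show ?thesis using M by (auto simp: matchings_def)
qed

text \<open>A cell with a hole may have any subset of \<open>C\<close>: the crude bound is harmless
  because at most two cells have holes.\<close>

definition cell_choices :: "(nat \<times> nat) set \<Rightarrow> nat \<times> nat \<Rightarrow> (nat \<times> nat) set set" where
  "cell_choices M = (\<lambda>(c, i). if intact M c i then cell_matchings s C (used M c i) else Pow C)"

text \<open>States with equal profile use the same links, so the cell parts determine the state;
  each part lies among the choices of its cell.\<close>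

lemma card_same_profile:
  assumes M0: "M0 \<in> states G"
  shows "card {M \<in> states G. profile M = profile M0} \<le> (\<Prod>x\<in>cells. card (cell_choices M0 x))"
proof -
  have m: "M \<in> matchings G" if "M \<in> states G" for M
    using that by (simp add: states_iff[OF bigraph_G])
  let ?F = "{M \<in> states G. profile M = profile M0}"
  let ?h = "\<lambda>M. restrict (\<lambda>(c, i). cell_part M c i) cells"
  have "card ?F \<le> card (Pi\<^sub>E cells (cell_choices M0))"
  proof (rule card_inj_on_le)
    show "inj_on ?h ?F"
    proof (rule inj_onI)
      fix M M' assume M: "M \<in> ?F" "M' \<in> ?F" and eq: "?h M = ?h M'"
      have mm: "M \<in> matchings G" "M' \<in> matchings G" using M m by auto
      have "cell_part M c i = cell_part M' c i" if "c < r" "i < k" for c i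
        using fun_cong[OF eq, of "(c, i)"] that by simp
      moreover have "used M c j = used M' c j" if "c < r" "j \<le> k" for c j
        using used_profile[OF mm _ that] M by simp
      ultimately show "M = M'" using matching_eqI[OF mm] by blast
    qed
    show "?h ` ?F \<subseteq> Pi\<^sub>E cells (cell_choices M0)"
    proof (rule image_subsetI)
      fix M assume M: "M \<in> ?F"
      then have mM: "M \<in> matchings G" and eq: "profile M = profile M0" using m by auto
      have "cell_part M c i \<in> cell_choices M0 (c, i)" if c: "c < r" "i < k" for c i
      proof (cases "intact M0 c i")
        case True
        then have "intact M c i" using holes_profile[OF eq c] by (simp add: intact_def)
        then show ?thesis
          using cell_part_intact[OF mM c] used_profile[OF mM m[OF M0] eq c(1), of i] c True
          by (simp add: cell_choices_def)
      next
        case False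
        then show ?thesis using cell_part_sub[OF mM c(1)] by (simp add: cell_choices_def)
      qed
      then show "?h M \<in> Pi\<^sub>E cells (cell_choices M0)" by (auto simp: PiE_iff)
    qed
    have "finite (cell_choices M0 x)" for x
      by (cases x) (simp add: cell_choices_def finite_cell_matchings finite_C)
    then show "finite (Pi\<^sub>E cells (cell_choices M0))" by (intro finite_PiE) auto
  qed
  then show ?thesis by (simp add: card_PiE)
qed

lemma lhole_unmatched:
  assumes M: "M \<in> states G" and h: "node c i a \<notin> fst ` M" "c < r" "i < k" "a < s"
    and c: "c' < r" "i' < k"
  shows "lhole M c' i' = (if c' = c \<and> i' = i then {a} else {})"
proof -
  have "node c i a = node c' i' a'" if "a' \<in> lhole M c' i'" for a'
    by (rule unmatched_unique(1)[OF bigraph_G M]) (use that h c in \<open>auto simp: lhole_def\<close>)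
  then have "c' = c \<and> i' = i \<and> a' = a" if "a' \<in> lhole M c' i'" for a'
    using that by (metis node_eq_iff)
  note only = this
  have a: "a \<in> lhole M c i" using h by (simp add: lhole_def)
  show ?thesis
  proof (cases "c' = c \<and> i' = i")
    case True
    then have "a \<in> lhole M c' i'" using a by simp
    then have "lhole M c' i' = {a}" using only by blast
    then show ?thesis using True by simp
  next
    case False
    then have "lhole M c' i' = {}" using only by blast
    then show ?thesis using False by simp
  qed
qed

lemma rhole_unmatched:
  assumes M: "M \<in> states G" and h: "node c i a \<notin> snd ` M" "c < r" "i < k" "a < s"
    and c: "c' < r" "i' < k"
  shows "rhole M c' i' = (if c' = c \<and> i' = i then {a} else {})"
proof -
  have "node c i a = node c' i' a'" if "a' \<in> rhole M c' i'" for a'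
    by (rule unmatched_unique(2)[OF bigraph_G M]) (use that h c in \<open>auto simp: rhole_def\<close>)
  then have "c' = c \<and> i' = i \<and> a' = a" if "a' \<in> rhole M c' i'" for a'
    using that by (metis node_eq_iff)
  note only = this
  have a: "a \<in> rhole M c i" using h by (simp add: rhole_def)
  show ?thesis
  proof (cases "c' = c \<and> i' = i")
    case True
    then have "a \<in> rhole M c' i'" using a by simp
    then have "rhole M c' i' = {a}" using only by blast
    then show ?thesis using True by simp
  next
    case False
    then have "rhole M c' i' = {}" using only by blast
    then show ?thesis using False by simp
  qed
qed

lemma card_not_intact:
  assumes M: "M \<in> states G"
  shows "card {x \<in> cells. \<not> intact M (fst x) (snd x)} \<le> 2"
proof -
  let ?L = "{x \<in> cells. lhole M (fst x) (snd x) \<noteq> {}}"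
  let ?R = "{x \<in> cells. rhole M (fst x) (snd x) \<noteq> {}}"
  have "card ?L \<le> 1"
  proof -
    have "x = y" if m: "x \<in> ?L" "y \<in> ?L" for x y
    proof -
      obtain a where "a \<in> lhole M (fst x) (snd x)" using m(1) by blast
      then have a: "node (fst x) (snd x) a \<notin> fst ` M" "a < s" by (simp_all add: lhole_def)
      have xy: "fst x < r" "snd x < k" "fst y < r" "snd y < k" "lhole M (fst y) (snd y) \<noteq> {}"
        using m by auto
      then show ?thesis
        using lhole_unmatched[OF M a(1) xy(1,2) a(2) xy(3,4)] by (metis prod_eqI)
    qed
    then show ?thesis by (simp add: card_le_Suc0_iff_eq)
  qed
  moreover have "card ?R \<le> 1"
  proof -
    have "x = y" if m: "x \<in> ?R" "y \<in> ?R" for x y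
    proof -
      obtain a where "a \<in> rhole M (fst x) (snd x)" using m(1) by blast
      then have a: "node (fst x) (snd x) a \<notin> snd ` M" "a < s" by (simp_all add: rhole_def)
      have xy: "fst x < r" "snd x < k" "fst y < r" "snd y < k" "rhole M (fst y) (snd y) \<noteq> {}"
        using m by auto
      then show ?thesis
        using rhole_unmatched[OF M a(1) xy(1,2) a(2) xy(3,4)] by (metis prod_eqI)
    qed
    then show ?thesis by (simp add: card_le_Suc0_iff_eq)
  qed
  moreover have "{x \<in> cells. \<not> intact M (fst x) (snd x)} = ?L \<union> ?R"
    by (auto simp: intact_def)
  ultimately show ?thesis using card_Un_le[of ?L ?R] by simp
qed

text \<open>The cells crossed by an alternating path: both ports are matched along the chain, so by
  \<open>few\<close> such a cell has at most half as many matchings as an uncrossed intact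
  one.\<close>

definition through :: "(nat \<times> nat) set \<Rightarrow> (nat \<times> nat) set" where
  "through M = {x \<in> cells. intact M (fst x) (snd x) \<and> used M (fst x) (snd x) = 1}"

text \<open>Relative to A matchings for each cell, a cell in \<open>through M\<close> loses a factor
  2 and one of the at most two cells with holes gains at most \<open>2 ^ card C\<close>. Multiplying
  by \<open>2 ^ card (through M)\<close> replaces a division.\<close>

lemma card_same_profile_through:
  assumes M: "M \<in> states G"
  shows "card {M' \<in> states G. profile M' = profile M} * 2 ^ card (through M)
    \<le> card (cell_matchings s C 0) ^ (r * k) * (2 ^ card C) ^ 2"
proof -
  let ?A = "card (cell_matchings s C 0)" and ?K = "2 ^ card C :: nat"
  let ?O = "{x \<in> cells. \<not> intact M (fst x) (snd x)}"
  have "0 < card (cell_matchings s C 1)" using ne finite_cell_matchings by (simp add: card_gt_0_iff)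
  then have A1: "1 \<le> ?A" using few by linarith
  have "card {M' \<in> states G. profile M' = profile M} * 2 ^ card (through M)
      \<le> (\<Prod>x\<in>cells. card (cell_choices M x)) * (\<Prod>x\<in>cells. if x \<in> through M then 2 else 1)"
  proof (rule mult_mono[OF card_same_profile[OF M]])
    have "cells \<inter> through M = through M" by (auto simp: through_def)
    then show "2 ^ card (through M) \<le> (\<Prod>x\<in>cells. if x \<in> through M then 2 else 1 :: nat)"
      by (subst prod.If_cases) (auto simp: Collect_mem_eq)
  qed auto
  also have "\<dots> = (\<Prod>x\<in>cells. card (cell_choices M x) * (if x \<in> through M then 2 else 1))"
    by (simp add: prod.distrib)
  also have "\<dots> \<le> (\<Prod>x\<in>cells. ?A * (if x \<in> ?O then ?K else 1))"
  proof (rule prod_mono, intro conjI)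
    fix x assume x: "x \<in> cells"
    obtain c i where ci: "x = (c, i)" by fastforce
    have "used M c i = 0 \<or> used M c i = 1" by (simp add: used_def)
    then show "card (cell_choices M x) * (if x \<in> through M then 2 else 1) \<le> ?A * (if x \<in> ?O then ?K else 1)"
      using x few A1 by (auto simp: ci cell_choices_def through_def card_Pow finite_C)
  qed simp
  also have "\<dots> = ?A ^ (r * k) * ?K ^ card ?O"
  proof -
    have "(\<Prod>x\<in>cells. if x \<in> ?O then ?K else 1) = ?K ^ card (cells \<inter> ?O)"
      by (subst prod.If_cases) (simp_all only: prod_constant Collect_mem_eq prod.neutral_const mult_1_right power_one
          finite_cartesian_product finite_lessThan)
    moreover have "cells \<inter> ?O = ?O" by blast
    ultimately show ?thesis by (simp only: prod.distrib prod_constant card_cartesian_product card_lessThan)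
  qed
  also have "\<dots> \<le> ?A ^ (r * k) * ?K ^ 2"
    using card_not_intact[OF M] by (intro mult_left_mono power_increasing) auto
  finally show ?thesis .
qed

text \<open>Each side has \<open>r * k * s + 1\<close> vertices and at most one hole, possibly none:
  hence the \<open>+ 2\<close>. The factor \<open>2 ^ r\<close> is a crude count of the sets of
  chains whose link 0 is used.\<close>

lemma card_profiles: "card (profile ` states G) \<le> (r * k * s + 2) ^ 2 * 2 ^ r"
proof -
  let ?U = "insert {} ((\<lambda>x. {x}) ` lverts G)"
  have sub: "X \<in> ?U" if "X \<subseteq> lverts G" "card X \<le> 1" for X
  proof -
    have "finite X" using that(1) finite_subset by fastforce
    then show ?thesis using that by (cases "X = {}") (auto simp: le_Suc_eq card_1_singleton_iff)
  qed
  have "profile ` states G \<subseteq> ?U \<times> ?U \<times> Pow {..<r}"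
  proof (rule image_subsetI)
    fix M assume "M \<in> states G"
    then have M: "M \<in> matchings G" "card (lverts G) \<le> card M + 1" by (simp_all add: states_iff[OF bigraph_G])
    have "lverts G - fst ` M \<in> ?U"
      by (rule sub) (use card_unmatched(1)[OF bigraph_G M(1)] M(2) in auto)
    moreover have "rverts G - snd ` M \<in> ?U"
      by (rule sub) (use card_unmatched(2)[OF bigraph_G M(1)] M(2) in auto)
    ultimately show "profile M \<in> ?U \<times> ?U \<times> Pow {..<r}" by (auto simp: profile_def)
  qed
  then have "card (profile ` states G) \<le> card (?U \<times> ?U \<times> Pow {..<r})"
    by (intro card_mono) auto
  also have "\<dots> = card ?U * card ?U * 2 ^ r"
    by (simp only: card_cartesian_product card_Pow finite_lessThan card_lessThan mult.assoc)
  also have "card ?U \<le> r * k * s + 2"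
  proof -
    have "card ?U \<le> Suc (card ((\<lambda>x. {x}) ` lverts G))" by (rule card_insert_le_m1) auto
    also have "\<dots> \<le> Suc (card (lverts G))" by (intro Suc_le_mono[THEN iffD2] card_image_le) simp
    finally show ?thesis using card_lverts by simp
  qed
  then have "card ?U * card ?U * 2 ^ r \<le> (r * k * s + 2) * (r * k * s + 2) * 2 ^ r"
    by (intro mult_mono) auto
  finally show ?thesis by (simp add: power2_eq_square)
qed

text \<open>The states in \<open>B\<close> are grouped by profile. One member of a group with at
  least \<open>w\<close> crossed cells bounds the whole group, by
  \<open>card_same_profile_through\<close>.\<close>

lemma card_le_through:
  assumes B: "B \<subseteq> states G" and w: "\<And>M. M \<in> B \<Longrightarrow> w \<le> card (through M)"
  shows "card B * 2 ^ w \<le> (r * k * s + 2) ^ 2 * 2 ^ r * (card (cell_matchings s C 0) ^ (r * k) * (2 ^ card C) ^ 2)"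
proof -
  let ?X = "card (cell_matchings s C 0) ^ (r * k) * (2 ^ card C) ^ 2"
  have finB: "finite B" using B finite_states(1)[OF bigraph_G] finite_subset by blast
  have "B = (\<Union>p\<in>profile ` B. {M \<in> B. profile M = p})" by blast
  then have "card B \<le> (\<Sum>p\<in>profile ` B. card {M \<in> B. profile M = p})"
    using card_UN_le[of "profile ` B" "\<lambda>p. {M \<in> B. profile M = p}"] finB by simp
  then have "card B * 2 ^ w \<le> (\<Sum>p\<in>profile ` B. card {M \<in> B. profile M = p} * 2 ^ w)"
    by (simp flip: sum_distrib_right)
  also have "\<dots> \<le> (\<Sum>p\<in>profile ` B. ?X)"
  proof (rule sum_mono)
    fix p assume "p \<in> profile ` B"
    then obtain M where M: "M \<in> B" "p = profile M" by blast
    have "card {M' \<in> B. profile M' = p} \<le> card {M' \<in> states G. profile M' = profile M}"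
      using B M finite_states(1)[OF bigraph_G] by (intro card_mono) auto
    then have "card {M' \<in> B. profile M' = p} * 2 ^ w
        \<le> card {M' \<in> states G. profile M' = profile M} * 2 ^ card (through M)"
      using w[OF M(1)] by (intro mult_mono power_increasing) auto
    also have "\<dots> \<le> ?X" using card_same_profile_through B M by blast
    finally show "card {M' \<in> B. profile M' = p} * 2 ^ w \<le> ?X" .
  qed
  also have "\<dots> \<le> card (profile ` states G) * ?X"
    using B finite_states(1)[OF bigraph_G] by (auto intro!: mult_right_mono card_mono)
  also have "\<dots> \<le> (r * k * s + 2) ^ 2 * 2 ^ r * ?X"
    by (intro mult_right_mono card_profiles) simp
  finally show ?thesis .
qed

lemma card_through_chain:
  assumes "c < r" "i \<le> j" "j \<le> k" "\<And>l. i \<le> l \<Longrightarrow> l < j \<Longrightarrow> intact M c l \<and> used M c l = 1"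
  shows "j - i \<le> card (through M)"
proof -
  have "Pair c ` {i..<j} \<subseteq> through M" using assms by (auto simp: through_def)
  moreover have "finite (through M)"
    by (rule finite_subset[of _ cells]) (auto simp: through_def)
  ultimately have "card (Pair c ` {i..<j}) \<le> card (through M)" by (rule card_mono[rotated])
  then show ?thesis by (simp add: card_image inj_on_def)
qed

lemma card_through_full:
  assumes M: "M \<in> matchings G" and c: "c < r" "\<And>l. l < k \<Longrightarrow> intact M c l" and j: "j \<le> k" "used M c j = 1"
  shows "k \<le> card (through M)"
proof -
  have "used M c l = used M c 0" if "l \<le> k" for l
    using used_intact[OF M c(1), of 0 l] c(2) that by simp
  then have "used M c l = 1" if "l \<le> k" for l
    using j that by metis
  then show ?thesis using card_through_chain[of c 0 k M] c by simp
qed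

section \<open>Frontier states contain long paths\<close>

text \<open>The cell is matched internally, so it contains no hole. A move that changes it either
  removes an edge of a perfect matching or brings in an edge with a free end; such an edge must be a
  link whose outer end is the port of a neighbouring cell. The bounds on \<open>l\<close> make both
  neighbours cells, not hubs.\<close>

lemma frontier_cell_part:
  assumes c: "c < r" "0 < l" "Suc l < k" and \<mu>: "\<mu> \<in> cell_matchings s C 0"
    and M: "M \<in> frontier_states G {M \<in> states G. cell_part M c l = \<mu>}"
  shows "M \<in> perfect_matchings G \<or> node c (l - 1) 0 \<notin> fst ` M \<or> node c (Suc l) 0 \<notin> snd ` M"
proof (rule ccontr)
  assume neg: "\<not> ?thesis"
  obtain u v where MS: "M \<in> states G" "cell_part M c l = \<mu>" and e: "(u, v) \<in> edges G"
    and out: "broder_move G M (u, v) \<notin> {M \<in> states G. cell_part M c l = \<mu>}"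
    using M by (auto simp: frontier_states_def)
  have "broder_move G M (u, v) \<in> states G" using move_cases[OF bigraph_G MS(1) e] by blast
  then have ch: "cell_part (broder_move G M (u, v)) c l \<noteq> cell_part M c l" using out MS by simp
  have cov: "node c l a \<in> fst ` M" "node c l a \<in> snd ` M" if "a < s" for a
  proof -
    have "a \<in> fst ` cell_part M c l" "a \<in> snd ` cell_part M c l"
      using that \<mu> MS(2) by (simp_all add: cell_matchings_def)
    then show "node c l a \<in> fst ` M" "node c l a \<in> snd ` M" by (force simp: cell_part_def)+
  qed
  have inC: "a < s" "b < s" if "(a, b) \<in> C" for a b using that C_sub by auto
  consider (b) "M \<in> near_perfect_matchings_at G u v" "broder_move G M (u, v) = insert (u, v) M"
   | (c) "u \<notin> fst ` M" "broder_move G M (u, v) = insert (u, v) M - {e' \<in> M. snd e' = v}"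
   | (d) "v \<notin> snd ` M" "broder_move G M (u, v) = insert (u, v) M - {e' \<in> M. fst e' = u}"
    using neg ch unfolding broder_move_def prod.case by (smt (verit))
  then show False
  proof cases
    case b
    then have "u \<notin> fst ` M" by (auto simp: near_perfect_matchings_at_def)
    moreover obtain a b where "u = node c l a" "v = node c l b"
      using ch b(2) by (auto simp: cell_part_def)
    ultimately show False using e cell_edgeD c cov inC by blast
  next
    case c
    have "\<exists>b. v = node c l b"
    proof (rule ccontr)
      assume "\<nexists>b. v = node c l b"
      then have "cell_part (broder_move G M (u, v)) c l = cell_part M c l"
        unfolding c(2) cell_part_def by auto
      then show False using ch by simp
    qed
    then obtain b where v: "v = node c l b" by blast
    then show False
      using edge_to_node[OF e[unfolded v] assms(1)] cov(1) inC c(1) neg assms(2,3)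
      by (auto simp: link_def link_left_def)
  next
    case d
    have "\<exists>a. u = node c l a"
    proof (rule ccontr)
      assume "\<nexists>a. u = node c l a"
      then have "cell_part (broder_move G M (u, v)) c l = cell_part M c l"
        unfolding d(2) cell_part_def by auto
      then show False using ch by simp
    qed
    then obtain a where u: "u = node c l a" by blast
    then show False
      using edge_from_node[OF e[unfolded u] assms(1)] cov(2) inC d(1) neg assms(2,3)
      by (auto simp: link_def link_right_def)
  qed
qed

lemma hub_matched:
  assumes M: "M \<in> matchings G"
  shows "hub r \<in> fst ` M \<Longrightarrow> \<exists>c<r. used M c 0 = 1" "hub r \<in> snd ` M \<Longrightarrow> \<exists>c<r. used M c k = 1"
proof -
  have ME: "M \<subseteq> edges G" using M by (simp add: matchings_def)
  show "\<exists>c<r. used M c 0 = 1" if h: "hub r \<in> fst ` M"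
  proof -
    obtain v where "(hub r, v) \<in> M" using h by auto
    then show ?thesis using edge_from_hub[of v] ME unfolding used_def by (metis subsetD)
  qed
  show "\<exists>c<r. used M c k = 1" if h: "hub r \<in> snd ` M"
  proof -
    obtain u where "(u, hub r) \<in> M" using h by auto
    then show ?thesis using edge_to_hub[of u] ME unfolding used_def by (metis subsetD)
  qed
qed

text \<open>The left hub is matched into some chain, and without holes every link of that chain is
  used.\<close>

lemma through_perfect:
  assumes M: "M \<in> perfect_matchings G"
  shows "k \<le> card (through M)"
proof -
  have mM: "M \<in> matchings G" using M by (simp add: perfect_matchings_def)
  have "fst ` M = lverts G" "snd ` M = rverts G" using M by (simp_all add: perfect_matchings_def)
  then have int: "intact M c i" if "c < r" "i < k" for c i
    using that by (auto simp: intact_def lhole_def rhole_def)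
  obtain c where "c < r" "used M c 0 = 1"
    using hub_matched(1)[OF mM] \<open>fst ` M = lverts G\<close> by auto
  then show ?thesis using card_through_full[OF mM, of c 0] int by simp
qed

text \<open>
  If the other hole lies on the same side of cell \<open>l\<close>, the hub of this side is matched into another
  chain, which is then traversed completely.
\<close>

lemma through_lhole:
  assumes M: "M \<in> states G" and l: "0 < l" "l < k" and z: "used M 0 l = 0"
    and w: "node 0 (l - 1) 0 \<notin> fst ` M"
  shows "l - 1 \<le> card (through M)"
proof -
  have mM: "M \<in> matchings G" using M by (simp add: states_iff[OF bigraph_G])
  have lh: "lhole M c i = (if c = 0 \<and> i = l - 1 then {0} else {})" if "c < r" "i < k" for c i
    using lhole_unmatched[OF M w r_pos _ s_pos that] l by simp
  show ?thesis
  proof (cases "\<forall>i<l. rhole M 0 i = {}")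
    case True
    have "used M 0 (l - 1) = 1"
      using balance[OF mM r_pos, of "l - 1"] lh[OF r_pos, of "l - 1"] True l z by simp
    moreover have int: "intact M 0 i" if "i < l - 1" for i
      using lh[OF r_pos, of i] True that l by (simp add: intact_def)
    ultimately have "used M 0 i = 1" if "i < l - 1" for i
      using used_intact[OF mM r_pos, of i "l - 1"] that l by simp
    then show ?thesis using card_through_chain[OF r_pos, of 0 "l - 1" M] int l by simp
  next
    case False
    then obtain i0 b where i0: "i0 < l" "b \<in> rhole M 0 i0" by blast
    then have b: "node 0 i0 b \<notin> snd ` M" "b < s" by (simp_all add: rhole_def)
    have rh: "rhole M c i = (if c = 0 \<and> i = i0 then {b} else {})" if "c < r" "i < k" for c i
      using rhole_unmatched[OF M b(1) r_pos _ b(2) that] l i0 by simp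
    have "(\<Sum>i\<in>{0..<l}. card (lhole M 0 i)) = (\<Sum>i\<in>{0..<l}. if i = l - 1 then 1 else 0)"
      using lh[OF r_pos] l by (intro sum.cong) auto
    moreover have "(\<Sum>i\<in>{0..<l}. card (rhole M 0 i)) = (\<Sum>i\<in>{0..<l}. if i = i0 then 1 else 0)"
      using rh[OF r_pos] l by (intro sum.cong) auto
    ultimately have u0: "used M 0 0 = 0"
      using balance_sum[OF mM r_pos, of 0 l] l i0 z by simp
    have "hub r \<in> fst ` M"
    proof (rule ccontr)
      assume "hub r \<notin> fst ` M"
      then have "node 0 (l - 1) 0 = hub r"
        by (intro unmatched_unique(1)[OF bigraph_G M]) (use w l r_pos s_pos in auto)
      then show False using r_pos by (simp add: hub_def)
    qed
    then obtain c where c: "c < r" "used M c 0 = 1" using hub_matched(1)[OF mM] by blast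
    then have "c \<noteq> 0" using u0 by (metis zero_neq_one)
    then have "intact M c i" if "i < k" for i
      using lh[OF c(1) that] rh[OF c(1) that] by (simp add: intact_def)
    then have "k \<le> card (through M)" using card_through_full[OF mM c(1) _ _ c(2)] by simp
    then show ?thesis using l by simp
  qed
qed

text \<open>The mirror image of \<open>through_lhole\<close>, with shifted index: here
  \<open>l\<close> is the cell with the hole, not the one before it, and the cells from
  \<open>Suc l\<close> to the end are crossed.\<close>

lemma through_rhole:
  assumes M: "M \<in> states G" and l: "l < k" and z: "used M 0 l = 0"
    and w: "node 0 l 0 \<notin> snd ` M"
  shows "k - Suc l \<le> card (through M)"
proof -
  have mM: "M \<in> matchings G" using M by (simp add: states_iff[OF bigraph_G])
  have rh: "rhole M c i = (if c = 0 \<and> i = l then {0} else {})" if "c < r" "i < k" for c i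
    using rhole_unmatched[OF M w r_pos l s_pos that] by simp
  show ?thesis
  proof (cases "\<forall>i. l \<le> i \<longrightarrow> i < k \<longrightarrow> lhole M 0 i = {}")
    case True
    have u: "used M 0 (Suc l) = 1"
      using balance[OF mM r_pos, of l] rh[OF r_pos, of l] True l z by simp
    have int: "intact M 0 i" if "Suc l \<le> i" "i < k" for i
      using rh[OF r_pos, of i] True that by (simp add: intact_def)
    have "used M 0 i = 1" if "Suc l \<le> i" "i < k" for i
      using used_intact[OF mM r_pos that(1)] that int u by simp
    then show ?thesis using card_through_chain[OF r_pos, of "Suc l" k M] int l by simp
  next
    case False
    then obtain i0 a where i0: "l \<le> i0" "i0 < k" "a \<in> lhole M 0 i0" by blast
    then have a: "node 0 i0 a \<notin> fst ` M" "a < s" by (simp_all add: lhole_def)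
    have lh: "lhole M c i = (if c = 0 \<and> i = i0 then {a} else {})" if "c < r" "i < k" for c i
      using lhole_unmatched[OF M a(1) r_pos i0(2) a(2) that] by simp
    have "(\<Sum>i\<in>{l..<k}. card (lhole M 0 i)) = (\<Sum>i\<in>{l..<k}. if i = i0 then 1 else 0)"
      using lh[OF r_pos] by (intro sum.cong) auto
    moreover have "(\<Sum>i\<in>{l..<k}. card (rhole M 0 i)) = (\<Sum>i\<in>{l..<k}. if i = l then 1 else 0)"
      using rh[OF r_pos] by (intro sum.cong) auto
    ultimately have u0: "used M 0 k = 0"
      using balance_sum[OF mM r_pos, of l k] l i0 z by simp
    have "hub r \<in> snd ` M"
    proof (rule ccontr)
      assume "hub r \<notin> snd ` M"
      then have "node 0 l 0 = hub r"
        by (intro unmatched_unique(2)[OF bigraph_G M]) (use w l r_pos s_pos in auto)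
      then show False using r_pos by (simp add: hub_def)
    qed
    then obtain c where c: "c < r" "used M c k = 1" using hub_matched(2)[OF mM] by blast
    then have "c \<noteq> 0" using u0 by (metis zero_neq_one)
    then have "intact M c i" if "i < k" for i
      using lh[OF c(1) that] rh[OF c(1) that] by (simp add: intact_def)
    then have "k \<le> card (through M)" using card_through_full[OF mM c(1) _ _ c(2)] by simp
    then show ?thesis by simp
  qed
qed

text \<open>With \<open>k = 2 * l + 1\<close> there are \<open>l\<close> cells on either side of the
  middle one. The neighbour with the hole does not count, which leaves \<open>l - 1\<close>.\<close>

lemma through_frontier:
  assumes k: "k = 2 * l + 1" "0 < l" and \<mu>: "\<mu> \<in> cell_matchings s C 0"
    and M: "M \<in> frontier_states G {M \<in> states G. cell_part M 0 l = \<mu>}"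
  shows "l - 1 \<le> card (through M)"
proof -
  have MS: "M \<in> states G" "cell_part M 0 l = \<mu>" using M by (simp_all add: frontier_states_def)
  have mM: "M \<in> matchings G" using MS by (simp add: states_iff[OF bigraph_G])
  have lk: "l < k" using k by simp
  have "0 \<in> fst ` cell_part M 0 l" "0 \<in> snd ` cell_part M 0 l"
    using \<mu> MS(2) s_pos by (simp_all add: cell_matchings_def)
  \<comment> \<open>A perfect matching of the middle cell covers both ports internally, so neither
    of the links at its ends is used.\<close>
  then have u: "used M 0 l = 0" "used M 0 (Suc l) = 0"
    using fst_cell_part[OF mM r_pos lk] snd_cell_part[OF mM r_pos lk]
    by (auto simp: used_def split: if_splits)
  have "M \<in> perfect_matchings G \<or> node 0 (l - 1) 0 \<notin> fst ` M \<or> node 0 (Suc l) 0 \<notin> snd ` M"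
    using frontier_cell_part[OF r_pos _ _ \<mu> M] k by simp
  then show ?thesis
  proof (elim disjE)
    assume "M \<in> perfect_matchings G"
    then show ?thesis using through_perfect k by fastforce
  next
    assume "node 0 (l - 1) 0 \<notin> fst ` M"
    then show ?thesis using through_lhole[OF MS(1) k(2) lk u(1)] by simp
  next
    assume "node 0 (Suc l) 0 \<notin> snd ` M"
    then show ?thesis using through_rhole[OF MS(1) _ u(2)] k by simp
  qed
qed

text \<open>Every \<open>S \<mu>\<close> has at least A^(r k - 1) states, so whichever of two such
  sets is small enough serves. The frontier bound contains A^(r k); the surplus factor A is a
  constant of the cell.\<close>

lemma bottleneck_exists:
  assumes k: "k = 2 * l + 1" "0 < l"
  shows "\<exists>S. S \<subseteq> states G \<and> S \<noteq> {} \<and> 2 * card S \<le> card (states G) \<and>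
    card (frontier_states G S) * 2 ^ (l - 1)
      \<le> (r * k * s + 2) ^ 2 * 2 ^ r * card (cell_matchings s C 0) * (2 ^ card C) ^ 2 * card S"
proof -
  let ?A = "card (cell_matchings s C 0)"
  define S where "S \<mu> = {M \<in> states G. cell_part M 0 l = \<mu>}" for \<mu>
  have "0 < card (cell_matchings s C 1)" using ne finite_cell_matchings by (simp add: card_gt_0_iff)
  then have "2 \<le> ?A" using few by linarith
  then have "\<not> card (cell_matchings s C 0) \<le> Suc 0" by simp
  then obtain \<mu>1 \<mu>2 where m: "\<mu>1 \<in> cell_matchings s C 0" "\<mu>2 \<in> cell_matchings s C 0" "\<mu>1 \<noteq> \<mu>2"
    unfolding card_le_Suc0_iff_eq[OF finite_cell_matchings] by blast
  have fin: "finite (S \<mu>)" for \<mu> using finite_states(1)[OF bigraph_G] by (simp add: S_def)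
  have "card (S \<mu>1) + card (S \<mu>2) = card (S \<mu>1 \<union> S \<mu>2)"
    by (rule card_Un_disjoint[symmetric]) (use fin m in \<open>auto simp: S_def\<close>)
  also have "\<dots> \<le> card (states G)"
    using finite_states(1)[OF bigraph_G] by (intro card_mono) (auto simp: S_def)
  finally have "2 * card (S \<mu>1) \<le> card (states G) \<or> 2 * card (S \<mu>2) \<le> card (states G)" by linarith
  then have "\<exists>\<mu>\<in>cell_matchings s C 0. 2 * card (S \<mu>) \<le> card (states G)" using m by blast
  then obtain \<mu> where \<mu>: "\<mu> \<in> cell_matchings s C 0" "2 * card (S \<mu>) \<le> card (states G)" by blast
  have z: "(0, l) \<in> cells" using r_pos k by simp
  have low: "?A ^ (r * k - 1) \<le> card (S \<mu>)"
    using card_cell_part_eq_ge[OF z \<mu>(1)] by (simp add: S_def)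
  have "0 < ?A ^ (r * k - 1)" using \<open>2 \<le> ?A\<close> by simp
  then have "S \<mu> \<noteq> {}" using low by (metis card.empty not_le)
  have "card (frontier_states G (S \<mu>)) * 2 ^ (l - 1)
      \<le> (r * k * s + 2) ^ 2 * 2 ^ r * (?A ^ (r * k) * (2 ^ card C) ^ 2)"
  proof (rule card_le_through)
    show "frontier_states G (S \<mu>) \<subseteq> states G" by (auto simp: frontier_states_def S_def)
    show "l - 1 \<le> card (through M)" if "M \<in> frontier_states G (S \<mu>)" for M
      using through_frontier[OF k \<mu>(1)] that by (simp add: S_def)
  qed
  also have "?A ^ (r * k) = ?A * ?A ^ (r * k - 1)"
    using r_pos k_pos by (simp add: power_eq_if)
  also have "(r * k * s + 2) ^ 2 * 2 ^ r * (?A * ?A ^ (r * k - 1) * (2 ^ card C) ^ 2)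
      \<le> (r * k * s + 2) ^ 2 * 2 ^ r * (?A * card (S \<mu>) * (2 ^ card C) ^ 2)"
    by (intro mult_le_mono low order_refl)
  finally have "card (frontier_states G (S \<mu>)) * 2 ^ (l - 1)
      \<le> (r * k * s + 2) ^ 2 * 2 ^ r * ?A * (2 ^ card C) ^ 2 * card (S \<mu>)"
    by (simp add: ac_simps)
  then show ?thesis using \<mu>(2) \<open>S \<mu> \<noteq> {}\<close> by (intro exI[of _ "S \<mu>"]) (auto simp: S_def)
qed

end

text \<open>\<open>Suc l\<close> makes the middle index positive and turns the exponent
  \<open>Suc l - 1\<close> into \<open>l\<close>. The constant 3 comes from bounding the chain
  length \<open>2 * Suc l + 1\<close> by \<open>3 * (l + 1)\<close>.\<close>

lemma theta_not_rapidly_mixing: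
  assumes tg: "\<And>k. 0 < k \<Longrightarrow> theta_graph r k s C"
    and mem: "\<And>k. 2 \<le> k \<Longrightarrow> theta r k s C \<in> \<GG>"
  shows "\<not> rapidly_mixing_on \<GG>"
proof (rule not_rapidly_mixingI[where G = "\<lambda>l. theta r (2 * Suc l + 1) s C" and c = "3 * r * s + 1"
      and C = "(3 * r * s + 2) ^ 2 * (2 ^ r * card (cell_matchings s C 0) * (2 ^ card C) ^ 2)"])
  fix l :: nat
  let ?k = "2 * Suc l + 1"
  let ?G = "theta r ?k s C"
  interpret theta_graph r ?k s C by (rule tg) simp
  show "?G \<in> \<GG>" by (rule mem) simp
  show "bigraph ?G" by (rule bigraph_G)
  show "lverts ?G \<noteq> {}" by simp
  show "perfect_matchings ?G \<noteq> {}" by (rule perfect_matchings_G)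
  have "?k \<le> 3 * (l + 1)" by simp
  then have rk: "r * ?k * s \<le> r * (3 * (l + 1)) * s" by (intro mult_le_mono order_refl)
  then show "card (lverts ?G) \<le> (3 * r * s + 1) * (l + 1)"
    unfolding card_lverts by (simp add: algebra_simps)
  have "r * ?k * s + 2 \<le> (3 * r * s + 2) * (l + 1)"
    using rk by (simp add: algebra_simps)
  then have sq: "(r * ?k * s + 2) ^ 2 \<le> (3 * r * s + 2) ^ 2 * (l + 1) ^ 2"
    unfolding power_mult_distrib[symmetric] by (rule power_mono) simp
  obtain S where S: "S \<subseteq> states ?G" "S \<noteq> {}" "2 * card S \<le> card (states ?G)"
    "card (frontier_states ?G S) * 2 ^ l
      \<le> (r * ?k * s + 2) ^ 2 * 2 ^ r * card (cell_matchings s C 0) * (2 ^ card C) ^ 2 * card S"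
    using bottleneck_exists[of "Suc l"] by auto
  note S(4)
  also have "(r * ?k * s + 2) ^ 2 * 2 ^ r * card (cell_matchings s C 0) * (2 ^ card C) ^ 2 * card S
      \<le> (3 * r * s + 2) ^ 2 * (l + 1) ^ 2 * 2 ^ r * card (cell_matchings s C 0) * (2 ^ card C) ^ 2 * card S"
    by (intro mult_le_mono sq order_refl)
  finally have "card (frontier_states ?G S) * 2 ^ l \<le>
    (3 * r * s + 2) ^ 2 * (2 ^ r * card (cell_matchings s C 0) * (2 ^ card C) ^ 2) * (l + 1) ^ 2 * card S"
    by (simp only: ac_simps)
  then show "\<exists>S. S \<subseteq> states ?G \<and> S \<noteq> {} \<and> 2 * card S \<le> card (states ?G) \<and>
    card (frontier_states ?G S) * 2 ^ l \<le>
    (3 * r * s + 2) ^ 2 * (2 ^ r * card (cell_matchings s C 0) * (2 ^ card C) ^ 2) * (l + 1) ^ 2 * card S"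
    using S(1-3) by blast
qed

section \<open>Regular, Hamiltonian and planar instances\<close>

text \<open>Two perfect matchings stand against the single edge that remains without the
  ports.\<close>

lemma theta_graph_square:
  assumes "0 < r" "0 < k" shows "theta_graph r k 2 ({..<2} \<times> {..<2})"
proof
  have "cell_matchings 2 ({..<2} \<times> {..<2}) 1 \<subseteq> {{(1, 1)}}"
  proof
    fix m assume "m \<in> cell_matchings 2 ({..<2} \<times> {..<2}) 1"
    then have "fst ` m = {1}" "snd ` m = {1}" by (auto simp: cell_matchings_def)
    then have "m \<subseteq> {(1, 1)}" "m \<noteq> {}" using subset_fst_snd[of m] by auto
    then show "m \<in> {{(1, 1)}}" by blast
  qed
  then have "card (cell_matchings 2 ({..<2} \<times> {..<2}) 1) \<le> card {{(1::nat, 1::nat)}}"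
    by (intro card_mono) auto
  moreover have "{{(0, 0), (1, 1)}, {(0, 1), (1, 0)}} \<subseteq> cell_matchings 2 ({..<2} \<times> {..<2}) 0"
    by (auto simp: cell_matchings_def)
  then have "card {{(0, 0), (1, 1)}, {(0::nat, 1::nat), (1, 0)}} \<le> card (cell_matchings 2 ({..<2} \<times> {..<2}) 0)"
    by (intro card_mono) (auto intro: finite_subset[of _ "Pow ({..<2} \<times> {..<2})"] simp: cell_matchings_def)
  ultimately show "2 * card (cell_matchings 2 ({..<2} \<times> {..<2}) 1) \<le> card (cell_matchings 2 ({..<2} \<times> {..<2}) 0)"
    by (simp add: doubleton_eq_iff)
  have "{(1, 1)} \<in> cell_matchings 2 ({..<2} \<times> {..<2}) 1" by (auto simp: cell_matchings_def)
  then show "cell_matchings 2 ({..<2} \<times> {..<2}) 1 \<noteq> {}" by blast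
qed (use assms in auto)

abbreviation K33_minus :: "(nat \<times> nat) set" where
  "K33_minus \<equiv> {..<3} \<times> {..<3} - {(0, 0)}"

text \<open>Of the six perfect matchings of K_{3,3}, two contain the edge between the ports; the
  other four stand against the two perfect matchings of the K_{2,2} that remains without the
  ports.\<close>

lemma theta_graph_K33_minus:
  assumes "0 < r" "0 < k" shows "theta_graph r k 3 K33_minus"
proof
  have "cell_matchings 3 K33_minus 1 \<subseteq> {{(1, 1), (2, 2)}, {(1, 2), (2, 1)}}"
  proof
    fix m assume m: "m \<in> cell_matchings 3 K33_minus 1"
    have "{1..<3::nat} = {1, 2}" by auto
    then have f: "fst ` m = {1, 2}" "snd ` m = {1, 2}" using m by (auto simp: cell_matchings_def)
    have un: "e = e'" if "e \<in> m" "e' \<in> m" "fst e = fst e' \<or> snd e = snd e'" for e e'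
      using m that unfolding cell_matchings_def by blast
    have "1 \<in> fst ` m" "2 \<in> fst ` m" using f by simp_all
    then obtain x y where xy: "(1, x) \<in> m" "(2, y) \<in> m" by auto
    have "x \<in> snd ` m" "y \<in> snd ` m" using xy by (metis imageI snd_conv)+
    then have xy': "x \<in> {1, 2}" "y \<in> {1, 2}" using f(2) by simp_all
    have "x \<noteq> y" using un[OF xy] by auto
    have "m \<subseteq> {(1, x), (2, y)}"
    proof
      fix e assume e: "e \<in> m"
      then have "fst e = 1 \<or> fst e = 2" using f(1) by blast
      then show "e \<in> {(1, x), (2, y)}" using un[OF e xy(1)] un[OF e xy(2)] by auto
    qed
    then have "m = {(1, x), (2, y)}" using xy by blast
    then show "m \<in> {{(1, 1), (2, 2)}, {(1, 2), (2, 1)}}" using xy' \<open>x \<noteq> y\<close> by auto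
  qed
  then have "card (cell_matchings 3 K33_minus 1) \<le> card {{(1::nat, 1::nat), (2, 2)}, {(1, 2), (2, 1)}}"
    by (intro card_mono) auto
  also have "\<dots> \<le> 2" by (simp add: card_insert_if)
  finally have up: "card (cell_matchings 3 K33_minus 1) \<le> 2" .
  let ?L = "[[(0::nat, 1::nat), (1, 0), (2, 2)], [(0, 1), (1, 2), (2, 0)], [(0, 2), (1, 0), (2, 1)], [(0, 2), (1, 1), (2, 0)]]"
  have "{..<3::nat} = {0, 1, 2}" "{0..<3::nat} = {0, 1, 2}" by auto
  then have "set ` set ?L \<subseteq> cell_matchings 3 K33_minus 0"
    by (simp add: cell_matchings_def insert_commute)
  then have "card (set ` set ?L) \<le> card (cell_matchings 3 K33_minus 0)"
    by (intro card_mono) (auto intro: finite_subset[of _ "Pow K33_minus"] simp: cell_matchings_def)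
  moreover have "card (set ` set ?L) = 4"
  proof -
    \<comment> \<open>The four matchings are told apart by which of the edges \<open>(0, 1)\<close>
      and \<open>(1, 0)\<close> they contain.\<close>
    have "inj_on set (set ?L)"
      by (rule inj_on_imageI2[of "\<lambda>m. ((0, 1) \<in> m, (1, 0) \<in> m)"]) (simp add: inj_on_def)
    moreover have "card (set ?L) = 4" by simp
    ultimately show ?thesis by (simp only: card_image)
  qed
  ultimately show "2 * card (cell_matchings 3 K33_minus 1) \<le> card (cell_matchings 3 K33_minus 0)"
    using up by linarith
  have "{1..<3::nat} = {1, 2}" by auto
  then have "{(1, 1), (2, 2)} \<in> cell_matchings 3 K33_minus 1" by (auto simp: cell_matchings_def)
  then show "cell_matchings 3 K33_minus 1 \<noteq> {}" by blast
qed (use assms in auto)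

section \<open>Vertex degrees and the cubic instance\<close>

context theta_graph
begin

lemma vdegree_Inl_node:
  assumes "c < r" "i < k"
  shows "vdegree G (Inl (node c i a)) = card {b. (a, b) \<in> C} + (if a = 0 then 1 else 0)"
proof -
  have "{v. (node c i a, v) \<in> edges G} =
      node c i ` {b. (a, b) \<in> C} \<union> (if a = 0 then {link_right r k c (Suc i)} else {})"
  proof (intro equalityI subsetI)
    fix v assume "v \<in> {v. (node c i a, v) \<in> edges G}"
    then show "v \<in> node c i ` {b. (a, b) \<in> C} \<union> (if a = 0 then {link_right r k c (Suc i)} else {})"
      using edge_from_node[OF _ assms(1), of i a v] by (auto simp: lk_Suc)
  next
    fix v assume "v \<in> node c i ` {b. (a, b) \<in> C} \<union> (if a = 0 then {link_right r k c (Suc i)} else {})"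
    then consider b where "v = node c i b" "(a, b) \<in> C" | "(node c i a, v) = lk c (Suc i)"
      by (auto simp: lk_Suc split: if_splits)
    then show "v \<in> {v. (node c i a, v) \<in> edges G}"
    proof cases
      case 1
      then show ?thesis using assms unfolding edges_G by blast
    next
      case 2
      then show ?thesis using assms unfolding edges_G by (metis (mono_tags, lifting) CollectI Suc_leI UnI2)
    qed
  qed
  moreover have "finite {b. (a, b) \<in> C}" using C_sub by (auto intro: finite_subset[of _ "{..<s}"])
  moreover have "link_right r k c (Suc i) \<notin> node c i ` {b. (a, b) \<in> C}"
    using link_right_Suc_neq[OF assms(1)] by blast
  moreover have "card (node c i ` {b. (a, b) \<in> C}) = card {b. (a, b) \<in> C}"
    by (simp add: card_image inj_on_def)
  ultimately show ?thesis by (cases "a = 0") (simp_all add: vdegree_Inl)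
qed

lemma vdegree_Inr_node:
  assumes "c < r" "i < k"
  shows "vdegree G (Inr (node c i b)) = card {a. (a, b) \<in> C} + (if b = 0 then 1 else 0)"
proof -
  have "{u. (u, node c i b) \<in> edges G} =
      node c i ` {a. (a, b) \<in> C} \<union> (if b = 0 then {link_left r c i} else {})"
  proof (intro equalityI subsetI)
    fix u assume "u \<in> {u. (u, node c i b) \<in> edges G}"
    then show "u \<in> node c i ` {a. (a, b) \<in> C} \<union> (if b = 0 then {link_left r c i} else {})"
      using edge_to_node[OF _ assms(1), of u i b] by (auto simp: lk_less[OF assms(2)])
  next
    fix u assume "u \<in> node c i ` {a. (a, b) \<in> C} \<union> (if b = 0 then {link_left r c i} else {})"
    then consider a where "u = node c i a" "(a, b) \<in> C" | "(u, node c i b) = lk c i"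
      by (auto simp: lk_less[OF assms(2)] split: if_splits)
    then show "u \<in> {u. (u, node c i b) \<in> edges G}"
    proof cases
      case 1
      then show ?thesis using assms unfolding edges_G by blast
    next
      case 2
      then show ?thesis using assms unfolding edges_G by (metis (mono_tags, lifting) CollectI less_imp_le UnI2)
    qed
  qed
  moreover have "finite {a. (a, b) \<in> C}" using C_sub by (auto intro: finite_subset[of _ "{..<s}"])
  moreover have "link_left r c i \<notin> node c i ` {a. (a, b) \<in> C}"
    using link_left_neq[OF assms(1)] by blast
  moreover have "card (node c i ` {a. (a, b) \<in> C}) = card {a. (a, b) \<in> C}"
    by (simp add: card_image inj_on_def)
  ultimately show ?thesis by (cases "b = 0") (simp_all add: vdegree_Inr)
qed

lemma vdegree_hub: "vdegree G (Inl (hub r)) = r" "vdegree G (Inr (hub r)) = r"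
proof -
  have "{v. (hub r, v) \<in> edges G} = (\<lambda>c. link_right r k c 0) ` {..<r}"
  proof (intro equalityI subsetI)
    fix v assume "v \<in> {v. (hub r, v) \<in> edges G}"
    then show "v \<in> (\<lambda>c. link_right r k c 0) ` {..<r}"
      using edge_from_hub by (force simp: link_def)
  next
    fix v assume "v \<in> (\<lambda>c. link_right r k c 0) ` {..<r}"
    then obtain c where "c < r" "(hub r, v) = lk c 0" by (auto simp: link_def link_left_def)
    then show "v \<in> {v. (hub r, v) \<in> edges G}" unfolding edges_G by blast
  qed
  moreover have "inj_on (\<lambda>c. link_right r k c 0) {..<r}"
    using k_pos by (auto simp: inj_on_def link_right_def)
  ultimately show "vdegree G (Inl (hub r)) = r" by (simp add: vdegree_Inl card_image)
  have "{u. (u, hub r) \<in> edges G} = (\<lambda>c. link_left r c k) ` {..<r}"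
  proof (intro equalityI subsetI)
    fix v assume "v \<in> {u. (u, hub r) \<in> edges G}"
    then show "v \<in> (\<lambda>c. link_left r c k) ` {..<r}"
      using edge_to_hub by (force simp: link_def)
  next
    fix v assume "v \<in> (\<lambda>c. link_left r c k) ` {..<r}"
    then obtain c where "c < r" "(v, hub r) = lk c k" by (auto simp: link_def link_right_def)
    then show "v \<in> {u. (u, hub r) \<in> edges G}" unfolding edges_G by blast
  qed
  moreover have "inj_on (\<lambda>c. link_left r c k) {..<r}"
    using k_pos by (auto simp: inj_on_def link_left_def)
  ultimately show "vdegree G (Inr (hub r)) = r" by (simp add: vdegree_Inr card_image)
qed

end

text \<open>Each port trades the deleted edge between the ports for a link, and each hub has one
  link per chain, which is why three chains are used.\<close>

lemma regular_theta:
  assumes "0 < k" shows "regular (theta 3 k 3 K33_minus)"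
proof -
  interpret theta_graph 3 k 3 K33_minus by (rule theta_graph_K33_minus) (use assms in auto)
  have d: "card {b. (a, b) \<in> K33_minus} = (if a = 0 then 2 else 3)"
    "card {b. (b, a) \<in> K33_minus} = (if a = 0 then 2 else 3)" if "a < 3" for a
  proof -
    have "{b. (a, b) \<in> K33_minus} = (if a = 0 then {1, 2} else {0, 1, 2})"
      "{b. (b, a) \<in> K33_minus} = (if a = 0 then {1, 2} else {0, 1, 2})"
      using that by auto
    then show "card {b. (a, b) \<in> K33_minus} = (if a = 0 then 2 else 3)"
      "card {b. (b, a) \<in> K33_minus} = (if a = 0 then 2 else 3)" by simp_all
  qed
  have "vdegree G x = 3" if "x \<in> verts G" for x
    using that unfolding verts_def cell_nodes_def theta_simps
    by (elim PlusE insertE CollectE exE conjE)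
      (simp_all only: vdegree_hub vdegree_Inl_node vdegree_Inr_node d split: if_splits, simp_all)
  then show ?thesis by (auto simp: regular_def)
qed

section \<open>A Hamiltonian cycle through two chains\<close>

text \<open>A Hamiltonian path of the square from the port where the chain enters to the port where
  it leaves.\<close>

fun chain_cell :: "nat \<Rightarrow> nat \<Rightarrow> (nat + nat) list" where
  "chain_cell c i = [Inr (node c i 0), Inl (node c i 1), Inr (node c i 1), Inl (node c i 0)]"

definition chain_path :: "nat \<Rightarrow> nat \<Rightarrow> (nat + nat) list" where
  "chain_path c n = concat (map (chain_cell c) [0..<n])"

lemma chain_path_Suc: "chain_path c (Suc n) = chain_path c n @ chain_cell c n"
  by (simp add: chain_path_def)

lemma chain_path_0 [simp]: "chain_path c 0 = []"
  by (simp add: chain_path_def)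

lemma hd_chain_path: "0 < n \<Longrightarrow> hd (chain_path c n) = Inr (node c 0 0)"
  by (simp add: chain_path_def upt_conv_Cons)

lemma last_chain_path: "0 < n \<Longrightarrow> last (chain_path c n) = Inl (node c (n - 1) 0)"
  by (cases n) (auto simp: chain_path_Suc)

lemma chain_path_eq_Nil: "chain_path c n = [] \<longleftrightarrow> n = 0"
  by (cases n) (auto simp: chain_path_Suc)

lemma set_chain_path: "set (chain_path c n) = {node c i a | i a. i < n \<and> a < 2} <+> {node c i a | i a. i < n \<and> a < 2}"
proof (induction n)
  case 0
  then show ?case by (simp add: Plus_def)
next
  case (Suc n)
  have "{node c i a | i a. i < Suc n \<and> a < 2} = {node c i a | i a. i < n \<and> a < 2} \<union> {node c n 0, node c n 1}"
    by (auto simp: less_Suc_eq less_2_cases_iff)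
  then show ?case using Suc by (auto simp: chain_path_Suc Plus_def)
qed

lemma distinct_chain_path: "distinct (chain_path c n)"
  by (induction n) (auto simp: chain_path_Suc set_chain_path)

lemma adjacent_sym: "adjacent G x y \<longleftrightarrow> adjacent G y x"
  by (auto simp: adjacent_def)

lemma adjacent_edge: "adjacent G (Inl u) (Inr v) \<longleftrightarrow> (u, v) \<in> edges G"
  "adjacent G (Inr v) (Inl u) \<longleftrightarrow> (u, v) \<in> edges G"
  by (auto simp: adjacent_def)

lemma hamiltonianI:
  assumes "distinct xs" "set xs = verts G" "3 \<le> length xs" "successively (adjacent G) xs"
    "adjacent G (last xs) (hd xs)"
  shows "hamiltonian G"
  unfolding hamiltonian_def
proof (intro exI[of _ xs] conjI allI impI assms)
  fix i assume i: "i < length xs"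
  show "adjacent G (xs ! i) (xs ! ((i + 1) mod length xs))"
  proof (cases "Suc i < length xs")
    case True
    have "successively P ys \<Longrightarrow> Suc i < length ys \<Longrightarrow> P (ys ! i) (ys ! Suc i)" for P i and ys :: "('a + 'b) list"
      by (induction P ys arbitrary: i rule: successively.induct) (auto simp: nth_Cons split: nat.splits)
    from this[OF assms(4) True] show ?thesis using True by simp
  next
    case False
    then have "i + 1 = length xs" using i by simp
    then have l: "i = length xs - 1" "(i + 1) mod length xs = 0" by auto
    moreover have "xs \<noteq> []" using i by auto
    ultimately show ?thesis using assms(5) by (simp add: last_conv_nth hd_conv_nth)
  qed
qed

lemma hamiltonian_theta:
  assumes k: "0 < k" shows "hamiltonian (theta 2 k 2 ({..<2} \<times> {..<2}))"
proof -
  interpret theta_graph 2 k 2 "{..<2} \<times> {..<2}" by (rule theta_graph_square) (use assms in auto)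
  have cellE: "(node c i a, node c i b) \<in> edges G" if "c < 2" "i < k" "a < 2" "b < 2" for c i a b
    using that unfolding edges_G by blast
  have lkE: "lk c j \<in> edges G" if "c < 2" "j \<le> k" for c j
    using that unfolding edges_G by blast
  have path: "successively (adjacent G) (chain_path c n)" if "c < 2" "n \<le> k" for c n
    using that(2)
  proof (induction n)
    case (Suc n)
    have "(node c (n - 1) 0, node c n 0) \<in> edges G" if "0 < n"
      using lkE[of c n] \<open>c < 2\<close> Suc.prems that by (simp add: link_def link_left_def link_right_def)
    then have "adjacent G (last (chain_path c n)) (Inr (node c n 0))" if "0 < n"
      using that by (simp add: last_chain_path adjacent_edge)
    then show ?case
      using Suc that(1) cellE[of c n]
      by (auto simp: chain_path_Suc successively_append_iff adjacent_edge chain_path_eq_Nil)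
  qed simp
  \<comment> \<open>Chain 0 leads from the left hub to the right one, and chain 1, reversed, closes
    the cycle.\<close>
  let ?xs = "Inl (hub 2) # chain_path 0 k @ Inr (hub 2) # rev (chain_path 1 k)"
  have vs: "verts G = set ?xs"
  proof -
    have "cell_nodes 2 k 2 = {node 0 i a | i a. i < k \<and> a < 2} \<union> {node 1 i a | i a. i < k \<and> a < 2}"
      unfolding cell_nodes_def by (auto simp: less_2_cases_iff)
    then show ?thesis unfolding verts_def theta_simps by (auto simp: set_chain_path)
  qed
  have h: "(hub 2, node c 0 0) \<in> edges G" "(node c (k - 1) 0, hub 2) \<in> edges G" if "c < 2" for c
    using lkE[OF that, of 0] lkE[OF that, of k] k by (auto simp: link_def link_left_def link_right_def)
  show ?thesis
  proof (rule hamiltonianI)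
    show "set ?xs = verts G" using vs by simp
    show "distinct ?xs"
      using distinct_chain_path by (auto simp: set_chain_path hub_def)
    show "3 \<le> length ?xs" using k by (cases k) (auto simp: chain_path_Suc)
    have "successively (\<lambda>x y. adjacent G y x) (chain_path 1 k)"
      using path[of 1 k] adjacent_sym[of G] by (simp add: successively_mono)
    then show "successively (adjacent G) ?xs"
      using path[of 0 k] h[of 0] h[of 1] k
      by (simp add: successively_append_iff successively_Cons hd_rev last_chain_path hd_chain_path
          chain_path_eq_Nil adjacent_edge hd_append)
    show "adjacent G (last ?xs) (hd ?xs)"
      using h[of 1] k by (simp add: last_rev hd_chain_path chain_path_eq_Nil adjacent_edge)
  qed
qed

section \<open>Plane drawings on the integer grid\<close>

text \<open>An inner point of a unit grid segment has exactly one coordinate that is not an integer;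
  rounding both coordinates down and up recovers the two grid points. So different segments have no
  inner point in common.\<close>

lemma unit_grid_segment:
  fixes p q :: "int \<times> int"
  defines "P \<equiv> \<lambda>w :: int \<times> int. Complex (of_int (fst w)) (of_int (snd w))"
  assumes unit: "\<bar>fst p - fst q\<bar> + \<bar>snd p - snd q\<bar> = 1" and z: "z \<in> closed_segment (P p) (P q)"
  shows "z = P p \<or> z = P q \<or> {p, q} = {(\<lfloor>Re z\<rfloor>, \<lfloor>Im z\<rfloor>), (\<lceil>Re z\<rceil>, \<lceil>Im z\<rceil>)}"
proof (rule ccontr)
  assume neg: "\<not> ?thesis"
  obtain t where t: "z = (1 - t) *\<^sub>R P p + t *\<^sub>R P q" "0 \<le> t" "t \<le> 1"
    using z by (auto simp: in_segment)
  have "t \<noteq> 0" "t \<noteq> 1" using t(1) neg by auto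
  then have t01: "0 < t" "t < 1" using t by auto
  have re: "Re z = of_int (fst p) + t * of_int (fst q - fst p)"
    and im: "Im z = of_int (snd p) + t * of_int (snd q - snd p)"
    unfolding t(1) P_def by (simp_all add: algebra_simps)
  have up: "\<lfloor>of_int a + t\<rfloor> = a" "\<lceil>of_int a + t\<rceil> = a + 1"
    and dn: "\<lfloor>of_int a - t\<rfloor> = a - 1" "\<lceil>of_int a - t\<rceil> = a" for a
    using t01 by (simp_all add: floor_eq_iff ceiling_eq_iff)
  have "fst q = fst p + 1 \<and> snd q = snd p \<or> fst q = fst p - 1 \<and> snd q = snd p \<or>
      fst q = fst p \<and> snd q = snd p + 1 \<or> fst q = fst p \<and> snd q = snd p - 1"
    using unit by presburger
  then consider "q = (fst p + 1, snd p)" | "q = (fst p - 1, snd p)" | "q = (fst p, snd p + 1)" | "q = (fst p, snd p - 1)"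
    by (metis prod.collapse)
  then show False
    using neg re im up dn by cases (auto simp: insert_commute prod_eq_iff)
qed

lemma planar_grid:
  fixes G :: "('a, 'b) bigraph" and p :: "'a + 'b \<Rightarrow> int \<times> int"
  assumes G: "edges G \<subseteq> lverts G \<times> rverts G" and inj: "inj_on p (verts G)"
    and unit: "\<And>u v. (u, v) \<in> edges G \<Longrightarrow>
      \<bar>fst (p (Inl u)) - fst (p (Inr v))\<bar> + \<bar>snd (p (Inl u)) - snd (p (Inr v))\<bar> = 1"
  shows "planar G"
proof -
  define P where "P = (\<lambda>w :: int \<times> int. Complex (of_int (fst w)) (of_int (snd w)))"
  define pos where "pos x = P (p x)" for x
  define \<gamma> where "\<gamma> = (\<lambda>(u, v). linepath (pos (Inl u)) (pos (Inr v)))"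
  have P_inj: "P w = P w' \<longleftrightarrow> w = w'" for w w' by (simp add: P_def complex_eq_iff prod_eq_iff)
  have vE: "Inl u \<in> verts G" "Inr v \<in> verts G" if "(u, v) \<in> edges G" for u v
    using that G by (auto simp: verts_def)
  have ne: "p (Inl u) \<noteq> p (Inr v)" if "(u, v) \<in> edges G" for u v
    using inj_onD[OF inj _ vE[OF that]] by auto
  have seg: "z = pos (Inl u) \<or> z = pos (Inr v) \<or>
      {p (Inl u), p (Inr v)} = {(\<lfloor>Re z\<rfloor>, \<lfloor>Im z\<rfloor>), (\<lceil>Re z\<rceil>, \<lceil>Im z\<rceil>)}"
    if "(u, v) \<in> edges G" "z \<in> path_image (\<gamma> (u, v))" for u v z
    using unit_grid_segment[OF unit[OF that(1)], of z] that(2) by (simp add: \<gamma>_def pos_def P_def)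
  show ?thesis
    unfolding planar_def
  proof (intro exI[of _ pos] exI[of _ \<gamma>] conjI ballI impI)
    show "inj_on pos (verts G)" using inj by (auto simp: inj_on_def pos_def P_inj)
  next
    fix e assume "e \<in> edges G"
    then obtain u v where e: "e = (u, v)" "(u, v) \<in> edges G" by (cases e) auto
    have "arc (\<gamma> (u, v))" using ne[OF e(2)] by (simp add: \<gamma>_def arc_linepath pos_def P_inj)
    moreover have "path_image (\<gamma> (u, v)) \<inter> pos ` verts G = {pos (Inl u), pos (Inr v)}"
    proof (intro equalityI subsetI)
      fix z assume z: "z \<in> path_image (\<gamma> (u, v)) \<inter> pos ` verts G"
      then obtain x where x: "z = P (p x)" by (auto simp: pos_def)
      \<comment> \<open>A drawn vertex has integer coordinates, so rounding down and up agree,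
        whereas the ends of an edge are distinct.\<close>
      then have "\<lfloor>Re z\<rfloor> = \<lceil>Re z\<rceil>" "\<lfloor>Im z\<rfloor> = \<lceil>Im z\<rceil>" by (simp_all add: P_def)
      then have "{p (Inl u), p (Inr v)} \<noteq> {(\<lfloor>Re z\<rfloor>, \<lfloor>Im z\<rfloor>), (\<lceil>Re z\<rceil>, \<lceil>Im z\<rceil>)}"
        using ne[OF e(2)] by (metis doubleton_eq_iff)
      then show "z \<in> {pos (Inl u), pos (Inr v)}"
        using seg[OF e(2), of z] z by blast
    next
      fix z assume "z \<in> {pos (Inl u), pos (Inr v)}"
      then show "z \<in> path_image (\<gamma> (u, v)) \<inter> pos ` verts G"
        using vE[OF e(2)] by (auto simp: \<gamma>_def)
    qed
    moreover have "pathstart (\<gamma> (u, v)) = pos (Inl u)" "pathfinish (\<gamma> (u, v)) = pos (Inr v)"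
      by (simp_all add: \<gamma>_def)
    ultimately show "case e of (u, v) \<Rightarrow> arc (\<gamma> (u, v)) \<and>
        pathstart (\<gamma> (u, v)) = pos (Inl u) \<and> pathfinish (\<gamma> (u, v)) = pos (Inr v) \<and>
        path_image (\<gamma> (u, v)) \<inter> pos ` verts G = {pos (Inl u), pos (Inr v)}"
      by (simp add: e(1))
  next
    fix e e' assume "e \<in> edges G" "e' \<in> edges G" "e \<noteq> e'"
    then obtain u v u' v' where e: "e = (u, v)" "(u, v) \<in> edges G" "e' = (u', v')" "(u', v') \<in> edges G"
      "(u, v) \<noteq> (u', v')" by (cases e, cases e') auto
    show "path_image (\<gamma> e) \<inter> path_image (\<gamma> e') \<subseteq> pos ` verts G"
    proof
      fix z assume z: "z \<in> path_image (\<gamma> e) \<inter> path_image (\<gamma> e')"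
      have "{p (Inl u), p (Inr v)} \<noteq> {p (Inl u'), p (Inr v')}"
      proof
        assume "{p (Inl u), p (Inr v)} = {p (Inl u'), p (Inr v')}"
        then have "p ` {Inl u, Inr v} = p ` {Inl u', Inr v'}" by simp
        then have "{Inl u, Inr v} = {Inl u', Inr v'}"
          using inj_on_image_eq_iff[OF inj, of "{Inl u, Inr v}" "{Inl u', Inr v'}"]
            vE[OF e(2)] vE[OF e(4)] by blast
        then show False using e(5) by (auto simp: doubleton_eq_iff)
      qed
      then have "z \<in> {pos (Inl u), pos (Inr v), pos (Inl u'), pos (Inr v')}"
        using seg[OF e(2), of z] seg[OF e(4), of z] z e(1,3) by auto
      then show "z \<in> pos ` verts G" using vE[OF e(2)] vE[OF e(4)] by blast
    qed
  qed
qed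

text \<open>For one chain of squares, the two rows of the ladder are at heights 0 and 1.\<close>

definition ladder_pos :: "nat \<Rightarrow> nat + nat \<Rightarrow> int \<times> int" where
  "ladder_pos k x = (case x of
     Inl n \<Rightarrow> (case prod_decode n of (c, m) \<Rightarrow> case prod_decode m of (i, a) \<Rightarrow>
       if c = 0 then (if a = 0 then (2 * int i + 1, 0) else (2 * int i, 1)) else (- 1, 0))
   | Inr n \<Rightarrow> (case prod_decode n of (c, m) \<Rightarrow> case prod_decode m of (i, a) \<Rightarrow>
       if c = 0 then (if a = 0 then (2 * int i, 0) else (2 * int i + 1, 1)) else (2 * int k, 0)))"

lemma ladder_pos_simps [simp]:
  "ladder_pos k (Inl (node 0 i a)) = (if a = 0 then (2 * int i + 1, 0) else (2 * int i, 1))"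
  "ladder_pos k (Inr (node 0 i a)) = (if a = 0 then (2 * int i, 0) else (2 * int i + 1, 1))"
  "ladder_pos k (Inl (hub (Suc 0))) = (- 1, 0)"
  "ladder_pos k (Inr (hub (Suc 0))) = (2 * int k, 0)"
  by (simp_all add: ladder_pos_def node_def hub_def)

text \<open>Along both rows left and right vertices alternate, in opposite order, so the four edges
  of a cell are the sides of a unit square and the links are unit steps in the lower row, with the
  hubs at its two ends.\<close>

lemma planar_theta:
  assumes k: "0 < k" shows "planar (theta 1 k 2 ({..<2} \<times> {..<2}))"
proof -
  interpret theta_graph 1 k 2 "{..<2} \<times> {..<2}" by (rule theta_graph_square) (use assms in auto)
  show ?thesis
  proof (rule planar_grid)
    show "edges G \<subseteq> lverts G \<times> rverts G" using bigraph_G by (simp add: bigraph_def)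
    have L: "x = hub (Suc 0) \<or> (\<exists>i<k. x = node 0 i 0 \<or> x = node 0 i 1)"
      if "x \<in> insert (hub 1) (cell_nodes 1 k 2)" for x
      using that by (auto simp: cell_nodes_def less_2_cases_iff)
    show "inj_on (ladder_pos k) (verts G)"
    proof (rule inj_onI)
      fix x y assume xy: "x \<in> verts G" "y \<in> verts G" and eq: "ladder_pos k x = ladder_pos k y"
      have V: "x \<in> {Inl (hub (Suc 0)), Inr (hub (Suc 0))} \<or> (\<exists>i<k. x \<in> {Inl (node 0 i 0), Inl (node 0 i 1), Inr (node 0 i 0), Inr (node 0 i 1)})"
        if "x \<in> verts G" for x
        using that L unfolding verts_def theta_simps by (elim PlusE) force+
      show "x = y"
        using V[OF xy(1)] V[OF xy(2)] eq by (elim disjE exE conjE insertE emptyE) (simp_all, presburger+)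
    qed
    fix u v assume "(u, v) \<in> edges G"
    then consider i a b where "u = node 0 i a" "v = node 0 i b" "a < 2" "b < 2" | j where "(u, v) = lk 0 j" "j \<le> k"
      unfolding edges_G by auto
    then show "\<bar>fst (ladder_pos k (Inl u)) - fst (ladder_pos k (Inr v))\<bar> +
        \<bar>snd (ladder_pos k (Inl u)) - snd (ladder_pos k (Inr v))\<bar> = 1"
    proof cases
      case 1
      then show ?thesis by (auto simp: less_2_cases_iff)
    next
      case 2
      then show ?thesis using k by (auto simp: link_def link_left_def link_right_def of_nat_diff)
    qed
  qed
qed

theorem theorem1:
  shows "\<not> rapidly_mixing_on {G :: (nat, nat) bigraph. bigraph G \<and> planar G} \<and>
         \<not> rapidly_mixing_on {G :: (nat, nat) bigraph. bigraph G \<and> regular G} \<and>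
         \<not> rapidly_mixing_on {G :: (nat, nat) bigraph. bigraph G \<and> hamiltonian G} \<and>
         \<not> rapidly_mixing_on {G :: (nat, nat) bigraph. bigraph G \<and> threshold G}"
proof (intro conjI not_rapidly_mixing_threshold)
  have square: "bigraph (theta r k 2 ({..<2} \<times> {..<2}))" if "0 < r" "2 \<le> k" for r k
    using theta_graph.bigraph_G[OF theta_graph_square] that by simp
  have cubic: "bigraph (theta 3 k 3 K33_minus)" if "2 \<le> k" for k
    using theta_graph.bigraph_G[OF theta_graph_K33_minus] that by simp
  show "\<not> rapidly_mixing_on {G :: (nat, nat) bigraph. bigraph G \<and> planar G}"
  proof (rule theta_not_rapidly_mixing[OF theta_graph_square[of 1]])
    fix k :: nat assume "2 \<le> k"
    then show "theta 1 k 2 ({..<2} \<times> {..<2}) \<in> {G. bigraph G \<and> planar G}"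
      using square[of 1 k] planar_theta[of k] by simp
  qed simp_all
  show "\<not> rapidly_mixing_on {G :: (nat, nat) bigraph. bigraph G \<and> regular G}"
  proof (rule theta_not_rapidly_mixing[OF theta_graph_K33_minus[of 3]])
    fix k :: nat assume "2 \<le> k"
    then show "theta 3 k 3 K33_minus \<in> {G. bigraph G \<and> regular G}"
      using cubic[of k] regular_theta[of k] by simp
  qed simp_all
  show "\<not> rapidly_mixing_on {G :: (nat, nat) bigraph. bigraph G \<and> hamiltonian G}"
  proof (rule theta_not_rapidly_mixing[OF theta_graph_square[of 2]])
    fix k :: nat assume "2 \<le> k"
    then show "theta 2 k 2 ({..<2} \<times> {..<2}) \<in> {G. bigraph G \<and> hamiltonian G}"
      using square[of 2 k] hamiltonian_theta[of k] by simp
  qed simp_all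
qed

end
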